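(* There exists a strictly $4$-sparse $4$-cycle system of order $v$ if and only if $v\equiv 1 \pmod 8$.
   Context: A $4$-cycle is a cycle of length four, written $(a,b,c,d)$ with edges $\{a,b\},\{b,c\},\{c,d\},\{d,a\}$; its diagonals are the pairs $\{a,c\}$ and $\{b,d\}$. A $4$-cycle system of order $v$, $4\mathrm{CS}(v)$, is a pair $(V,\mathcal{C})$ where $V$ is the vertex set of $K_v$ and $\mathcal{C}$ is a collection of edge-disjoint $4$-cycles whose edges partition the edge set of $K_v$. A $(k,l)$-configuration in a $4$CS is a set of $l$ of its $4$-cycles whose union contains precisely $k$ vertices. A $4$CS is $r$-sparse if it contains no $(j+3,j)$-configuration for any integer $j$ with $2\le j\le r$. A double-diamond configuration is a pair of $4$-cycles of the form $(a,b,c,d)$ and $(a,e,c,f)$ (six distinct vertices), i.e. two $4$-cycles sharing a common diagonal. A $4$CS is $D$-avoiding if it contains no double-diamond configuration, and strictly $r$-sparse if it is both $r$-sparse and $D$-avoiding. *)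

theory Defs
  imports Main "HOL-Library.Disjoint_Sets"
begin

definition complete_edges :: "'a set \<Rightarrow> 'a set set" where
  "complete_edges V = {e. e \<subseteq> V \<and> card e = 2}"

text \<open>
  Cycles are represented by their edge sets, so the eight ways of writing a
  4-cycle as a tuple denote the same object.
\<close>

definition cycle4 :: "'a \<Rightarrow> 'a \<Rightarrow> 'a \<Rightarrow> 'a \<Rightarrow> 'a set set" where
  "cycle4 a b c d = {{a, b}, {b, c}, {c, d}, {d, a}}"

definition is_cycle4 :: "'a set set \<Rightarrow> bool" where
  "is_cycle4 X \<longleftrightarrow> (\<exists>a b c d. distinct [a, b, c, d] \<and> X = cycle4 a b c d)"

definition four_cycle_system :: "nat \<Rightarrow> 'a set \<Rightarrow> 'a set set set \<Rightarrow> bool" where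
  "four_cycle_system v V \<C> \<longleftrightarrow>
     finite V \<and> card V = v \<and> (\<forall>X\<in>\<C>. is_cycle4 X) \<and> partition_on (complete_edges V) \<C>"

text \<open>
  The vertices of a cycle \<open>X\<close> are \<open>\<Union>X\<close>, so a set \<open>S\<close> of cycles covers the
  vertices \<open>\<Union>(\<Union>S)\<close>.
\<close>

definition configuration :: "'a set set set \<Rightarrow> nat \<Rightarrow> nat \<Rightarrow> 'a set set set \<Rightarrow> bool" where
  "configuration \<C> k l S \<longleftrightarrow>
     S \<subseteq> \<C> \<and> finite S \<and> card S = l \<and> finite (\<Union>(\<Union>S)) \<and> card (\<Union>(\<Union>S)) = k"

definition sparse :: "nat \<Rightarrow> 'a set set set \<Rightarrow> bool" where
  "sparse r \<C> \<longleftrightarrow> (\<forall>j. 2 \<le> j \<and> j \<le> r \<longrightarrow> \<not> (\<exists>S. configuration \<C> (j + 3) j S))"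

definition double_diamond :: "'a set set \<Rightarrow> 'a set set \<Rightarrow> bool" where
  "double_diamond X Y \<longleftrightarrow>
     (\<exists>a b c d e f. distinct [a, b, c, d, e, f] \<and> X = cycle4 a b c d \<and> Y = cycle4 a e c f)"

definition D_avoiding :: "'a set set set \<Rightarrow> bool" where
  "D_avoiding \<C> \<longleftrightarrow> \<not> (\<exists>X\<in>\<C>. \<exists>Y\<in>\<C>. double_diamond X Y)"

definition strictly_sparse :: "nat \<Rightarrow> 'a set set set \<Rightarrow> bool" where
  "strictly_sparse r \<C> \<longleftrightarrow> sparse r \<C> \<and> D_avoiding \<C>"

end

theory Submission
  imports Defs
begin

text \<open>
  Necessity is counting: all degrees of \<open>K\<^sub>v\<close> are even, and \<open>4\<close> divides the number of edges.

  For sufficiency, note that two cycles of a system share at most two vertices, and a shared pair is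
  a diagonal of exactly one of the two cycles if no double diamond occurs. A parity argument then
  excludes three cycles on six vertices. Fix a vertex \<open>x\<close> and map \<open>y\<close> to the vertex opposite to
  \<open>x\<close> in the cycle through the edge \<open>{x, y}\<close>. Four cycles on seven vertices produce an edge
  \<open>{x, y}\<close> such that \<open>y\<close> has period three for the map at \<open>x\<close>, and \<open>x\<close> for the map at \<open>y\<close>.
  In a cyclic system on the integers modulo \<open>8 * n + 1\<close> this says that both \<open>t\<close> and \<open>- t\<close>
  have period three under a single map of differences. For \<open>n \<ge> 2\<close> there are base cycles, in three
  arithmetic progressions and one additional cycle, for which that map is piecewise linear and the
  two periodicity conditions contradict each other. The cases \<open>n \<le> 1\<close> are treated directly.
\<close>

section \<open>Edges and diagonals of a 4-cycle\<close>

text \<open>Period three cannot simply be forbidden: it does occur with the base cycles used here,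
  for instance 12 -> 49 -> 39 -> 12 for n = 13. Hence the weaker demand on t and - t together.

  The shape of the base cycles comes from counting differences. A base cycle is a zero-sum quadruple
  of differences, and n of them have to use each of 1, ..., 4n once up to sign. Moving a quadruple
  by (i, i, i, -3i) keeps the sum; three entries sweep intervals, the fourth a progression of step
  3. Three such progressions interlock to fill one more interval, which explains their number and
  the split by n modulo 3. The additional cycle takes the four differences left over.

  Sums of neighbouring entries move with step 2, so each linear piece of the map of differences has
  slope of absolute value 2 or 2/3. A product of three such slopes is never 1, so a closed walk
  through three given pieces has at most one solution. It depends linearly on the parameter, and
  linear arithmetic can treat all n at once.\<close>

definition diagonal :: "'a set set \<Rightarrow> 'a \<Rightarrow> 'a \<Rightarrow> bool" where
  "diagonal X x z \<longleftrightarrow> x \<noteq> z \<and> (\<exists>y. {x, y} \<in> X \<and> {y, z} \<in> X)"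

lemma is_cycle4E:
  assumes "is_cycle4 X"
  obtains a b c d where "distinct [a, b, c, d]" "X = cycle4 a b c d"
  using assms unfolding is_cycle4_def by blast

lemma Union_cycle4 [simp]: "\<Union>(cycle4 a b c d) = {a, b, c, d}"
  unfolding cycle4_def by auto

lemma edge_cycle4_iff:
  "{x, y} \<in> cycle4 a b c d \<longleftrightarrow>
     x = a \<and> y = b \<or> x = b \<and> y = a \<or> x = b \<and> y = c \<or> x = c \<and> y = b \<or>
     x = c \<and> y = d \<or> x = d \<and> y = c \<or> x = d \<and> y = a \<or> x = a \<and> y = d"
  unfolding cycle4_def by (simp add: doubleton_eq_iff disj_assoc)

lemma diagonal_cycle4_iff:
  assumes "distinct [a, b, c, d]"
  shows "diagonal (cycle4 a b c d) x z \<longleftrightarrow>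
     x = a \<and> z = c \<or> x = c \<and> z = a \<or> x = b \<and> z = d \<or> x = d \<and> z = b"
  using assms unfolding diagonal_def edge_cycle4_iff by (simp, safe) auto

lemma card_cycle4: "is_cycle4 X \<Longrightarrow> card X = 4"
  by (erule is_cycle4E) (auto simp: cycle4_def doubleton_eq_iff card_insert_if)

lemma finite_cycle4: "is_cycle4 X \<Longrightarrow> finite X"
  by (erule is_cycle4E) (simp add: cycle4_def)

lemma card_vertices_cycle4: "is_cycle4 X \<Longrightarrow> card (\<Union>X) = 4"
  by (erule is_cycle4E) simp

lemma finite_vertices_cycle4: "is_cycle4 X \<Longrightarrow> finite (\<Union>X)"
  by (erule is_cycle4E) simp

text \<open>Of the six pairs of vertices four are edges and two are diagonals; the packing arguments
  rest on this dichotomy.\<close>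

lemma edge_iff_not_diagonal:
  assumes "is_cycle4 X" "x \<in> \<Union>X" "y \<in> \<Union>X" "x \<noteq> y"
  shows "{x, y} \<in> X \<longleftrightarrow> \<not> diagonal X x y"
  using assms(1)
proof (rule is_cycle4E)
  fix a b c d assume X: "distinct [a, b, c, d]" "X = cycle4 a b c d"
  have "x = a \<or> x = b \<or> x = c \<or> x = d" "y = a \<or> y = b \<or> y = c \<or> y = d"
    using assms(2,3) X(2) by auto
  then show ?thesis
    using assms(4) X(1) unfolding X(2) edge_cycle4_iff diagonal_cycle4_iff[OF X(1)]
    by (elim disjE) auto
qed

lemma diagonal_cases:
  assumes "is_cycle4 X" "diagonal X x z"
  obtains y w where "distinct [x, y, z, w]" "X = cycle4 x y z w"
proof -
  obtain a b c d where X: "distinct [a, b, c, d]" "X = cycle4 a b c d"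
    using assms(1) by (rule is_cycle4E)
  have "x = a \<and> z = c \<or> x = c \<and> z = a \<or> x = b \<and> z = d \<or> x = d \<and> z = b"
    using assms(2) unfolding X(2) diagonal_cycle4_iff[OF X(1)] .
  moreover have "X = cycle4 c d a b" "X = cycle4 b c d a" "X = cycle4 d a b c"
    unfolding X(2) cycle4_def by blast+
  ultimately show ?thesis
    using X that[of b d] that[of d b] that[of c a] that[of a c] by auto
qed

lemma diagonal_sym: "diagonal X x z \<Longrightarrow> diagonal X z x"
  unfolding diagonal_def by (metis insert_commute)

lemma diagonal_unique:
  assumes "is_cycle4 X" "diagonal X x y" "diagonal X x z"
  shows "y = z"
  using assms(1)
proof (rule is_cycle4E)
  fix a b c d assume X: "distinct [a, b, c, d]" "X = cycle4 a b c d"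
  show ?thesis
    using assms(2,3) X(1) unfolding X(2) diagonal_cycle4_iff[OF X(1)] by auto
qed

lemma diagonal_complement:
  assumes "is_cycle4 X" "\<Union>X = {p, q, r, s}" "distinct [p, q, r, s]" "diagonal X p q"
  shows "diagonal X r s"
proof -
  obtain y w where yw: "distinct [p, y, q, w]" "X = cycle4 p y q w"
    using assms(1,4) by (rule diagonal_cases)
  have "{p, y, q, w} = {p, q, r, s}"
    using assms(2) unfolding yw(2) Union_cycle4 .
  then have "{y, w} = {r, s}"
    using yw(1) assms(3) by auto
  then show ?thesis
    unfolding yw(2) diagonal_cycle4_iff[OF yw(1)] doubleton_eq_iff by blast
qed

section \<open>Edge-disjoint 4-cycles without double diamonds\<close>

lemma card_2_pairE:
  assumes "card T = 2" "x \<in> T"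
  obtains y where "T = {x, y}" "y \<noteq> x"
  using assms by (auto simp: card_2_iff)

text \<open>The deficits from 2 add up to at most one. The five full entries are written out so that
  \<open>no_7_4\<close> can conclude by propositional reasoning.\<close>

lemma five_of_six:
  fixes a b c d e f :: nat
  assumes "11 \<le> a + b + c + d + e + f" "a \<le> 2" "b \<le> 2" "c \<le> 2" "d \<le> 2" "e \<le> 2" "f \<le> 2"
  shows "a = 2 \<and> b = 2 \<and> c = 2 \<and> d = 2 \<and> e = 2 \<or> a = 2 \<and> b = 2 \<and> c = 2 \<and> d = 2 \<and> f = 2 \<or>
    a = 2 \<and> b = 2 \<and> c = 2 \<and> e = 2 \<and> f = 2 \<or> a = 2 \<and> b = 2 \<and> d = 2 \<and> e = 2 \<and> f = 2 \<or>
    a = 2 \<and> c = 2 \<and> d = 2 \<and> e = 2 \<and> f = 2 \<or> b = 2 \<and> c = 2 \<and> d = 2 \<and> e = 2 \<and> f = 2"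
proof -
  have two_or: "x = 2 \<or> x \<le> 1" if "x \<le> 2" for x :: nat
    using that by linarith
  have "a \<le> 1 \<Longrightarrow> b = 2 \<and> c = 2 \<and> d = 2 \<and> e = 2 \<and> f = 2"
    "b \<le> 1 \<Longrightarrow> a = 2 \<and> c = 2 \<and> d = 2 \<and> e = 2 \<and> f = 2"
    "c \<le> 1 \<Longrightarrow> a = 2 \<and> b = 2 \<and> d = 2 \<and> e = 2 \<and> f = 2"
    "d \<le> 1 \<Longrightarrow> a = 2 \<and> b = 2 \<and> c = 2 \<and> e = 2 \<and> f = 2"
    "e \<le> 1 \<Longrightarrow> a = 2 \<and> b = 2 \<and> c = 2 \<and> d = 2 \<and> f = 2"
    using assms by linarith+
  then show ?thesis
    using assms(2-6)[THEN two_or] by satx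
qed

text \<open>\<open>diagonal_disjoint\<close> is the absence of double diamonds in usable form:
  distinct edge-disjoint cycles with a common diagonal share no further vertex, so they form a
  double diamond.\<close>

locale cycle4_packing =
  fixes \<C> :: "'a set set set"
  assumes cycles: "X \<in> \<C> \<Longrightarrow> is_cycle4 X"
    and edge_disjoint: "X \<in> \<C> \<Longrightarrow> Y \<in> \<C> \<Longrightarrow> e \<in> X \<Longrightarrow> e \<in> Y \<Longrightarrow> X = Y"
    and diagonal_disjoint: "X \<in> \<C> \<Longrightarrow> Y \<in> \<C> \<Longrightarrow> diagonal X x z \<Longrightarrow> diagonal Y x z \<Longrightarrow> X = Y"
begin

lemmas finite_vertices = finite_vertices_cycle4[OF cycles]
  and card_vertices = card_vertices_cycle4[OF cycles]

lemma shared_pair: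
  assumes "X \<in> \<C>" "Y \<in> \<C>" "X \<noteq> Y" "x \<noteq> y" "x \<in> \<Union>X \<inter> \<Union>Y" "y \<in> \<Union>X \<inter> \<Union>Y"
  shows "diagonal Y x y \<longleftrightarrow> \<not> diagonal X x y"
  using assms edge_iff_not_diagonal[OF cycles, of X x y] edge_iff_not_diagonal[OF cycles, of Y x y]
    edge_disjoint[of X Y "{x, y}"] diagonal_disjoint[of X Y x y] by blast

text \<open>Three shared vertices form three pairs, each a diagonal of one of the two cycles. The
  diagonals of a cycle are disjoint, so each cycle accounts for at most one of these pairs.\<close>

lemma card_shared_le_2:
  assumes "X \<in> \<C>" "Y \<in> \<C>" "X \<noteq> Y"
  shows "card (\<Union>X \<inter> \<Union>Y) \<le> 2"
proof (rule ccontr)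
  assume "\<not> ?thesis"
  then have "3 \<le> card (\<Union>X \<inter> \<Union>Y)" by linarith
  then obtain T where "T \<subseteq> \<Union>X \<inter> \<Union>Y" "card T = 3"
    by (rule obtain_subset_with_card_n)
  then obtain x y z where xyz: "x \<noteq> y" "x \<noteq> z" "y \<noteq> z" "{x, y, z} \<subseteq> \<Union>X \<inter> \<Union>Y"
    unfolding card_3_iff by metis
  have one: "\<not> (diagonal Z x y \<and> diagonal Z x z)" "\<not> (diagonal Z x y \<and> diagonal Z y z)"
    "\<not> (diagonal Z x z \<and> diagonal Z y z)" if "Z \<in> \<C>" for Z
    using diagonal_unique[OF cycles[OF that], of x y z] diagonal_unique[OF cycles[OF that], of y x z]
      diagonal_unique[OF cycles[OF that], of z x y] diagonal_sym[of Z x y] diagonal_sym[of Z x z]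
      diagonal_sym[of Z y z] xyz(1-3) by satx+
  have "diagonal Y x y \<longleftrightarrow> \<not> diagonal X x y" "diagonal Y x z \<longleftrightarrow> \<not> diagonal X x z"
    "diagonal Y y z \<longleftrightarrow> \<not> diagonal X y z"
    using shared_pair[OF assms xyz(1)] shared_pair[OF assms xyz(2)] shared_pair[OF assms xyz(3)] xyz(4)
    unfolding insert_subset by satx+
  then show False
    using one[OF assms(1)] one[OF assms(2)] by satx
qed

lemma card_two_cycles:
  assumes "X \<in> \<C>" "Y \<in> \<C>"
  shows "card (\<Union>X \<union> \<Union>Y) + card (\<Union>X \<inter> \<Union>Y) = 8"
  using card_Un_Int[OF finite_vertices finite_vertices, OF assms] card_vertices assms by simp

text \<open>
  Three cycles on six vertices share three disjoint pairs of vertices, and each of these pairs is a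
  diagonal of one of the two cycles containing it and an edge of the other. Since the two pairs in
  a cycle are of the same kind, the two kinds alternate around a triangle, which is impossible.
\<close>

lemma card_three_cycles:
  assumes "A \<in> \<C>" "B \<in> \<C>" "D \<in> \<C>" "A \<noteq> B" "A \<noteq> D" "B \<noteq> D"
  shows "card (\<Union>A \<union> \<Union>B \<union> \<Union>D) \<noteq> 6"
proof
  assume six: "card (\<Union>A \<union> \<Union>B \<union> \<Union>D) = 6"
  \<comment> \<open>Any two of the cycles cover at least 8 - 2 = 6 vertices, hence all of
    them.\<close>
  have pair: "card (\<Union>X \<inter> \<Union>Y) = 2 \<and> \<Union>X \<union> \<Union>Y = \<Union>A \<union> \<Union>B \<union> \<Union>D"
    if "X \<in> {A, B, D}" "Y \<in> {A, B, D}" "X \<noteq> Y" for X Y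
  proof -
    have XY: "X \<in> \<C>" "Y \<in> \<C>" using that assms by auto
    have fin: "finite (\<Union>A \<union> \<Union>B \<union> \<Union>D)"
      using finite_vertices assms by blast
    have sub: "\<Union>X \<union> \<Union>Y \<subseteq> \<Union>A \<union> \<Union>B \<union> \<Union>D" using that by auto
    have "card (\<Union>X \<union> \<Union>Y) \<le> 6"
      using card_mono[OF fin sub] six by simp
    then have "card (\<Union>X \<inter> \<Union>Y) = 2" "card (\<Union>X \<union> \<Union>Y) = 6"
      using card_two_cycles[OF XY] card_shared_le_2[OF XY that(3)] by linarith+
    then show ?thesis
      using card_subset_eq[OF fin sub] six by simp
  qed
  obtain p p' where p: "\<Union>A \<inter> \<Union>B = {p, p'}" "p \<noteq> p'"
    using pair[of A B] assms by (auto simp: card_2_iff)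
  obtain q q' where q: "\<Union>A \<inter> \<Union>D = {q, q'}" "q \<noteq> q'"
    using pair[of A D] assms by (auto simp: card_2_iff)
  obtain r r' where r: "\<Union>B \<inter> \<Union>D = {r, r'}" "r \<noteq> r'"
    using pair[of B D] assms by (auto simp: card_2_iff)
  \<comment> \<open>\<open>Y\<close> and \<open>Z\<close> cover everything, so the four vertices of
    \<open>X\<close> split exactly into its two shared pairs.\<close>
  have split: "\<Union>X = (\<Union>X \<inter> \<Union>Y) \<union> (\<Union>X \<inter> \<Union>Z)" "(\<Union>X \<inter> \<Union>Y) \<inter> (\<Union>X \<inter> \<Union>Z) = {}"
    if mem: "X \<in> {A, B, D}" "Y \<in> {A, B, D}" "Z \<in> {A, B, D}" and neq: "X \<noteq> Y" "X \<noteq> Z" "Y \<noteq> Z" for X Y Z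
  proof -
    have "\<Union>X \<subseteq> \<Union>Y \<union> \<Union>Z"
      using pair[OF mem(2,3) neq(3)] pair[OF mem(1,2) neq(1)] by auto
    then show *: "\<Union>X = (\<Union>X \<inter> \<Union>Y) \<union> (\<Union>X \<inter> \<Union>Z)" by blast
    have "finite (\<Union>X)" "card (\<Union>X) = 4"
      using mem assms finite_vertices card_vertices by blast+
    then have "card ((\<Union>X \<inter> \<Union>Y) \<inter> (\<Union>X \<inter> \<Union>Z)) = 0"
      using card_Un_Int[of "\<Union>X \<inter> \<Union>Y" "\<Union>X \<inter> \<Union>Z"] pair[OF mem(1,2) neq(1)] pair[OF mem(1,3) neq(2)] *
      by simp
    then show "(\<Union>X \<inter> \<Union>Y) \<inter> (\<Union>X \<inter> \<Union>Z) = {}"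
      using \<open>finite (\<Union>X)\<close> by simp
  qed
  have "\<Union>A = {p, p'} \<union> {q, q'}" "{p, p'} \<inter> {q, q'} = {}"
    using split[of A B D, unfolded p(1) q(1)] assms(4-6) by simp_all
  then have A: "\<Union>A = {p, p', q, q'}" "distinct [p, p', q, q']"
    using p(2) q(2) by auto
  have "\<Union>B = {p, p'} \<union> {r, r'}" "{p, p'} \<inter> {r, r'} = {}"
    using split[of B A D, unfolded Int_commute[of "\<Union>B" "\<Union>A"] p(1) r(1)] assms(4-6) by simp_all
  then have B: "\<Union>B = {p, p', r, r'}" "distinct [p, p', r, r']"
    using p(2) r(2) by auto
  have "\<Union>D = {q, q'} \<union> {r, r'}" "{q, q'} \<inter> {r, r'} = {}"
    using split[of D A B, unfolded Int_commute[of "\<Union>D"] q(1) r(1)] assms(4-6) by simp_all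
  then have D: "\<Union>D = {q, q', r, r'}" "distinct [q, q', r, r']"
    using q(2) r(2) by auto
  have iff: "diagonal X a b \<longleftrightarrow> diagonal X c d" if "X \<in> \<C>" "\<Union>X = {a, b, c, d}" "distinct [a, b, c, d]"
    for X a b c d
  proof -
    have "\<Union>X = {c, d, a, b}" "distinct [c, d, a, b]" using that by auto
    then show ?thesis
      using diagonal_complement[OF cycles[OF that(1)]] that(2,3) by blast
  qed
  have "diagonal A p p' \<longleftrightarrow> diagonal A q q'" "diagonal B p p' \<longleftrightarrow> diagonal B r r'"
    "diagonal D q q' \<longleftrightarrow> diagonal D r r'"
    using iff[OF assms(1) A] iff[OF assms(2) B] iff[OF assms(3) D] .
  moreover have "diagonal B p p' \<longleftrightarrow> \<not> diagonal A p p'" "diagonal D q q' \<longleftrightarrow> \<not> diagonal A q q'"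
    "diagonal D r r' \<longleftrightarrow> \<not> diagonal B r r'"
    using shared_pair[OF assms(1,2,4) p(2)] shared_pair[OF assms(1,3,5) q(2)]
      shared_pair[OF assms(2,3,6) r(2)] p(1) q(1) r(1) by simp_all
  ultimately show False by blast
qed

text \<open>Two cycles on five vertices would share three, and three cycles on six are excluded by
  parity. Only four cycles on seven vertices depend on the particular system.\<close>

lemma sparse_4_if_no_7_4:
  assumes no_7_4: "\<And>S. \<not> configuration \<C> 7 4 S"
  shows "sparse 4 \<C>"
  unfolding sparse_def
proof (intro allI impI notI)
  fix j :: nat assume j: "2 \<le> j \<and> j \<le> 4" and "\<exists>S. configuration \<C> (j + 3) j S"
  then obtain S where S: "configuration \<C> (j + 3) j S" by blast
  consider "j = 2" | "j = 3" | "j = 4" using j by linarith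
  then show False
  proof cases
    case 1
    then have "card S = 2" "S \<subseteq> \<C>" and five: "card (\<Union>(\<Union>S)) = 5"
      using S unfolding configuration_def by simp_all
    then obtain X Y where XY: "S = {X, Y}" "X \<noteq> Y" "X \<in> \<C>" "Y \<in> \<C>"
      unfolding card_2_iff by blast
    have "\<Union>(\<Union>S) = \<Union>X \<union> \<Union>Y" using XY(1) by auto
    then show ?thesis
      using card_two_cycles[OF XY(3,4)] card_shared_le_2[OF XY(3,4,2)] five by simp
  next
    case 2
    then have "card S = 3" "S \<subseteq> \<C>" and six: "card (\<Union>(\<Union>S)) = 6"
      using S unfolding configuration_def by simp_all
    then obtain X Y Z where XYZ: "S = {X, Y, Z}" "X \<noteq> Y" "X \<noteq> Z" "Y \<noteq> Z" "X \<in> \<C>" "Y \<in> \<C>" "Z \<in> \<C>"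
      unfolding card_3_iff by blast
    have "\<Union>(\<Union>S) = \<Union>X \<union> \<Union>Y \<union> \<Union>Z" using XYZ(1) by auto
    then show ?thesis
      using card_three_cycles[OF XYZ(5-7) XYZ(2-4)] six by simp
  next
    case 3
    then show ?thesis using no_7_4 S by simp
  qed
qed

text \<open>
  Fix a vertex \<open>x\<close>, and send a vertex \<open>y\<close> to the vertex opposite to \<open>x\<close> in the cycle through the
  edge \<open>{x, y}\<close>. Then \<open>three_periodic x p\<close> says that \<open>p\<close> is periodic with period three.
\<close>

definition opposite :: "'a \<Rightarrow> 'a \<Rightarrow> 'a \<Rightarrow> bool" where
  "opposite x y z \<longleftrightarrow> (\<exists>X\<in>\<C>. {x, y} \<in> X \<and> diagonal X x z)"

definition three_periodic :: "'a \<Rightarrow> 'a \<Rightarrow> bool" where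
  "three_periodic x p \<longleftrightarrow> (\<exists>q r. opposite x p q \<and> opposite x q r \<and> opposite x r p)"

text \<open>By inclusion-exclusion the union has 12 - 6 + c vertices, where c counts the common
  ones; this is at most 7 and, by \<open>card_three_cycles\<close>, not 6.\<close>

lemma triangle_meet:
  assumes "A \<in> \<C>" "B \<in> \<C>" "D \<in> \<C>" "A \<noteq> B" "A \<noteq> D" "B \<noteq> D"
    and "card (\<Union>A \<inter> \<Union>B) = 2" "card (\<Union>A \<inter> \<Union>D) = 2" "card (\<Union>B \<inter> \<Union>D) = 2"
    and "card (\<Union>A \<union> \<Union>B \<union> \<Union>D) \<le> 7"
  obtains x where "\<Union>A \<inter> \<Union>B \<inter> \<Union>D = {x}"
proof -
  have fin: "finite (\<Union>A)" "finite (\<Union>B)" "finite (\<Union>D)"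
    using finite_vertices assms by blast+
  have "card (\<Union>A \<union> \<Union>B \<union> \<Union>D) + card ((\<Union>A \<union> \<Union>B) \<inter> \<Union>D) = 10"
    using card_Un_Int[of "\<Union>A \<union> \<Union>B" "\<Union>D"] card_two_cycles[OF assms(1,2)] card_vertices[OF assms(3)] assms(7) fin
    by simp
  moreover have "card ((\<Union>A \<union> \<Union>B) \<inter> \<Union>D) + card (\<Union>A \<inter> \<Union>B \<inter> \<Union>D) = 4"
  proof -
    have "(\<Union>A \<union> \<Union>B) \<inter> \<Union>D = (\<Union>A \<inter> \<Union>D) \<union> (\<Union>B \<inter> \<Union>D)"
      "\<Union>A \<inter> \<Union>B \<inter> \<Union>D = (\<Union>A \<inter> \<Union>D) \<inter> (\<Union>B \<inter> \<Union>D)" by auto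
    then show ?thesis
      using card_Un_Int[of "\<Union>A \<inter> \<Union>D" "\<Union>B \<inter> \<Union>D"] assms(8,9) fin by simp
  qed
  ultimately have "card (\<Union>A \<inter> \<Union>B \<inter> \<Union>D) = 1"
    using assms(10) card_three_cycles[OF assms(1-6)] by linarith
  then show ?thesis
    using that by (auto simp: card_1_singleton_iff)
qed

text \<open>
  In a triangle of cycles through a common vertex \<open>x\<close>, every cycle has at most one of its two
  shared pairs as a diagonal, so the three diagonals are distributed cyclically.
\<close>

lemma triangle_three_periodic:
  assumes "A \<in> \<C>" "B \<in> \<C>" "D \<in> \<C>" "A \<noteq> B" "A \<noteq> D" "B \<noteq> D"
    and "card (\<Union>A \<inter> \<Union>D) = 2" "card (\<Union>B \<inter> \<Union>D) = 2"
    and AB: "\<Union>A \<inter> \<Union>B = {x, y}" and "x \<noteq> y" and ABD: "\<Union>A \<inter> \<Union>B \<inter> \<Union>D = {x}" and "diagonal A x y"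
  shows "three_periodic x y \<and> (\<exists>r. diagonal B x r \<and> {x, r} \<in> D)"
proof -
  have x: "x \<in> \<Union>A" "x \<in> \<Union>B" "x \<in> \<Union>D" and y: "y \<in> \<Union>A" "y \<in> \<Union>B"
    using AB ABD by (metis IntD1 IntD2 insertCI)+
  obtain s where s: "\<Union>A \<inter> \<Union>D = {x, s}" "s \<noteq> x"
    using card_2_pairE[OF assms(7)] x by blast
  obtain r where r: "\<Union>B \<inter> \<Union>D = {x, r}" "r \<noteq> x"
    using card_2_pairE[OF assms(8)] x by blast
  have mem: "s \<in> \<Union>A" "s \<in> \<Union>D" "r \<in> \<Union>B" "r \<in> \<Union>D"
    using s(1) r(1) by (metis IntD1 IntD2 insertCI)+
  have "z = x" if "z \<in> \<Union>A" "z \<in> \<Union>B" "z \<in> \<Union>D" for z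
    using ABD that by (metis IntI singletonD)
  then have neq: "y \<noteq> s" "y \<noteq> r" "r \<noteq> s"
    using mem y \<open>x \<noteq> y\<close> r(2) by metis+
  \<comment> \<open>The vertices \<open>y\<close>, \<open>s\<close>, \<open>r\<close> are shared
    with \<open>x\<close> by the pairs of cycles \<open>A B\<close>, \<open>A D\<close>,
    \<open>B D\<close>. A shared pair is a diagonal in one cycle and an edge in the other, and a
    cycle has one diagonal at \<open>x\<close>. So the diagonal of \<open>A\<close> determines that
    of \<open>D\<close>, then that of \<open>B\<close>, and the orbit is \<open>y\<close>,
    \<open>r\<close>, \<open>s\<close>.\<close>
  have xy: "\<not> diagonal B x y"
    using shared_pair[OF assms(1,2,4) \<open>x \<noteq> y\<close>] AB \<open>diagonal A x y\<close> by simp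
  have xs: "\<not> diagonal A x s"
    using diagonal_unique[OF cycles[OF assms(1)] \<open>diagonal A x y\<close>] neq by metis
  then have xs': "diagonal D x s"
    using shared_pair[OF assms(1,3,5) s(2)[symmetric]] s(1) by simp
  have xr: "\<not> diagonal D x r"
    using diagonal_unique[OF cycles[OF assms(3)] xs'] neq by metis
  then have xr': "diagonal B x r"
    using shared_pair[OF assms(2,3,6) r(2)[symmetric]] r(1) by simp
  have "{x, y} \<in> B"
    using edge_iff_not_diagonal[OF cycles[OF assms(2)] x(2) y(2) \<open>x \<noteq> y\<close>] xy by simp
  moreover have "{x, s} \<in> A"
    using edge_iff_not_diagonal[OF cycles[OF assms(1)] x(1) mem(1) s(2)[symmetric]] xs by simp
  moreover have "{x, r} \<in> D"
    using edge_iff_not_diagonal[OF cycles[OF assms(3)] x(3) mem(4) r(2)[symmetric]] xr by simp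
  ultimately show ?thesis
    unfolding three_periodic_def opposite_def
    using assms(1-3) xs' xr' \<open>diagonal A x y\<close> by meson
qed

text \<open>The triangles \<open>A B D\<close> and \<open>A B E\<close> both have their common
  vertex in the pair shared by \<open>A\<close> and \<open>B\<close>. If these vertices agree, then
  \<open>D = E\<close>; otherwise they are the two ends of the pair, each of period three at the
  other.\<close>

lemma no_7_4_aux:
  assumes "A \<in> \<C>" "B \<in> \<C>" "D \<in> \<C>" "E \<in> \<C>" and neq: "A \<noteq> B" "A \<noteq> D" "B \<noteq> D" "A \<noteq> E" "B \<noteq> E" "D \<noteq> E"
    and AB: "card (\<Union>A \<inter> \<Union>B) = 2" and AD: "card (\<Union>A \<inter> \<Union>D) = 2" and BD: "card (\<Union>B \<inter> \<Union>D) = 2"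
    and AE: "card (\<Union>A \<inter> \<Union>E) = 2" and BE: "card (\<Union>B \<inter> \<Union>E) = 2"
    and small: "card (\<Union>A \<union> \<Union>B \<union> \<Union>D) \<le> 7" "card (\<Union>A \<union> \<Union>B \<union> \<Union>E) \<le> 7"
    and no: "\<And>x y. \<not> (three_periodic x y \<and> three_periodic y x)"
  shows False
proof -
  obtain x where x: "\<Union>A \<inter> \<Union>B \<inter> \<Union>D = {x}"
    using triangle_meet[OF assms(1-3) neq(1-3) AB AD BD small(1)] .
  obtain y where y: "\<Union>A \<inter> \<Union>B \<inter> \<Union>E = {y}"
    using triangle_meet[OF assms(1,2,4) neq(1,4,5) AB AE BE small(2)] .
  \<comment> \<open>\<open>A\<close> and \<open>B\<close> are generalized because the shared pair
    may be a diagonal of either; the second case below exchanges them.\<close>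
  have key: False
    if "A \<in> \<C>" "B \<in> \<C>" "A \<noteq> B" "A \<noteq> D" "B \<noteq> D" "A \<noteq> E" "B \<noteq> E"
      and "card (\<Union>A \<inter> \<Union>B) = 2" "card (\<Union>A \<inter> \<Union>D) = 2" "card (\<Union>B \<inter> \<Union>D) = 2"
      "card (\<Union>A \<inter> \<Union>E) = 2" "card (\<Union>B \<inter> \<Union>E) = 2"
      and x: "\<Union>A \<inter> \<Union>B \<inter> \<Union>D = {x}" and y: "\<Union>A \<inter> \<Union>B \<inter> \<Union>E = {y}"
      and z: "\<Union>A \<inter> \<Union>B = {x, z}" "z \<noteq> x" and diag: "diagonal A x z" for A B z
  proof -
    have xz: "three_periodic x z \<and> (\<exists>r. diagonal B x r \<and> {x, r} \<in> D)"
      using triangle_three_periodic[OF that(1,2) assms(3) that(3-5,9,10) z(1) z(2)[symmetric] x diag] .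
    have "y \<in> {x, z}" using y z(1) by blast
    then consider "y = x" | "y = z" by blast
    then show False
    proof cases
      \<comment> \<open>The vertex opposite to \<open>x\<close> in \<open>B\<close> is unique, and
        the edge from \<open>x\<close> to it lies in the third cycle of each triangle; so the third
        cycles coincide.\<close>
      case 1
      have "\<exists>r. diagonal B x r \<and> {x, r} \<in> E"
        using triangle_three_periodic[OF that(1,2) assms(4) that(3,6,7,11,12) z(1) z(2)[symmetric] y[unfolded 1] diag] by blast
      then show False
        using xz diagonal_unique[OF cycles[OF that(2)]] edge_disjoint[OF assms(3,4)] neq(6) by metis
    next
      case 2
      have "\<Union>A \<inter> \<Union>B = {z, x}" using z(1) by (simp add: insert_commute)
      then have "three_periodic z x"
        using triangle_three_periodic[OF that(1,2) assms(4) that(3,6,7,11,12) _ z(2) y[unfolded 2] diagonal_sym[OF diag]] by blast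
      then show False using no xz by blast
    qed
  qed
  have "x \<in> \<Union>A \<inter> \<Union>B" using x by blast
  then obtain z where z: "\<Union>A \<inter> \<Union>B = {x, z}" "z \<noteq> x"
    by (rule card_2_pairE[OF AB])
  have comm: "\<Union>B \<inter> \<Union>A = \<Union>A \<inter> \<Union>B" by (rule Int_commute)
  show False
  proof (cases "diagonal A x z")
    case True
    show False
      using key[OF assms(1,2) neq(1,2,3,4,5) AB AD BD AE BE x y z True] .
  next
    case False
    then have diag: "diagonal B x z"
      using shared_pair[OF assms(1,2) neq(1) z(2)[symmetric]] z(1) by simp
    have BA: "card (\<Union>B \<inter> \<Union>A) = 2" "\<Union>B \<inter> \<Union>A \<inter> \<Union>D = {x}" "\<Union>B \<inter> \<Union>A \<inter> \<Union>E = {y}"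
      "\<Union>B \<inter> \<Union>A = {x, z}"
      unfolding comm by (fact AB x y z(1))+
    show False
      using key[OF assms(2,1) neq(1)[symmetric] neq(3,2,5,4) BA(1) BD AD BE AE BA(2-4) z(2) diag] .
  qed
qed

text \<open>
  Summing \<open>r choose 2 \<ge> 2 * r - 3\<close> over the seven vertices, where \<open>r\<close> is the number of
  cycles through the vertex, shows that at most one of the six pairs of cycles fails to share two
  vertices.
\<close>

lemma no_7_4:
  assumes no: "\<And>x y. \<not> (three_periodic x y \<and> three_periodic y x)"
  shows "\<not> configuration \<C> 7 4 S"
proof
  assume S: "configuration \<C> 7 4 S"
  then have "card S = Suc 3"
    unfolding configuration_def by simp
  then obtain A B D E where ABDE: "S = {A, B, D, E}" and neq: "A \<noteq> B" "A \<noteq> D" "A \<noteq> E" "B \<noteq> D" "B \<noteq> E" "D \<noteq> E"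
  proof -
    from \<open>card S = Suc 3\<close> obtain A T where T: "S = insert A T" "A \<notin> T" "card T = 3"
      unfolding card_Suc_eq by blast
    then obtain B D E where "T = {B, D, E}" "B \<noteq> D" "B \<noteq> E" "D \<noteq> E"
      unfolding card_3_iff by blast
    then show ?thesis using T that[of A B D E] by simp
  qed
  have mem: "A \<in> \<C>" "B \<in> \<C>" "D \<in> \<C>" "E \<in> \<C>"
    using S ABDE unfolding configuration_def by auto
  define U where "U = \<Union>A \<union> \<Union>B \<union> \<Union>D \<union> \<Union>E"
  have "\<Union>(\<Union>S) = U" unfolding U_def ABDE by auto
  then have U: "finite U" "card U = 7"
    using S unfolding configuration_def by auto
  have card_eq: "int (card T) = (\<Sum>x\<in>U. of_bool (x \<in> T))" if "T \<subseteq> U" for T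
    using U(1) that by (simp add: sum.If_cases of_bool_def Int_absorb1)
  let ?c = "\<lambda>X Y. card (\<Union>X \<inter> \<Union>Y)"
  let ?b = "\<lambda>X x. of_bool (x \<in> \<Union>X) :: int"
  have four: "(\<Sum>x\<in>U. ?b X x) = 4" if "X \<in> \<C>" "\<Union>X \<subseteq> U" for X
    using card_eq[OF that(2)] card_vertices[OF that(1)] by simp
  have two: "int (card (\<Union>X \<inter> \<Union>Y)) = (\<Sum>x\<in>U. ?b X x * ?b Y x)" if "\<Union>X \<subseteq> U" for X Y
    using card_eq[of "\<Union>X \<inter> \<Union>Y"] that by (subst card_eq) (auto intro!: sum.cong)
  have sub: "\<Union>A \<subseteq> U" "\<Union>B \<subseteq> U" "\<Union>D \<subseteq> U" "\<Union>E \<subseteq> U"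
    unfolding U_def by blast+
  \<comment> \<open>With r cycles through the vertex this is (r - 2) * (r - 3) \<ge> 0 for integers:
    the chord of r choose 2 through 2 and 3, which enclose the mean 16/7.\<close>
  have "(\<Sum>x\<in>U. 2 * (?b A x + ?b B x + ?b D x + ?b E x) - 3) \<le>
    (\<Sum>x\<in>U. ?b A x * ?b B x + ?b A x * ?b D x + ?b A x * ?b E x + ?b B x * ?b D x + ?b B x * ?b E x + ?b D x * ?b E x)"
    by (intro sum_mono) (auto simp: of_bool_def)
  then have "2 * 16 - 3 * 7 \<le> int (?c A B) + int (?c A D) + int (?c A E) + int (?c B D) + int (?c B E) + int (?c D E)"
    using U(2) by (simp only: two[OF sub(1)] two[OF sub(2)] two[OF sub(3)] sum.distrib sum_subtractf
      sum_distrib_left[symmetric] four[OF mem(1) sub(1)] four[OF mem(2) sub(2)] four[OF mem(3) sub(3)] four[OF mem(4) sub(4)]) simp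
  then have sum: "11 \<le> ?c A B + ?c A D + ?c A E + ?c B D + ?c B E + ?c D E"
    by linarith
  have le: "?c A B \<le> 2" "?c A D \<le> 2" "?c A E \<le> 2" "?c B D \<le> 2" "?c B E \<le> 2" "?c D E \<le> 2"
    using card_shared_le_2 mem neq by metis+
  \<comment> \<open>On four cycles, all pairs but \<open>Z W\<close> being full means two full
    triangles glued along \<open>X Y\<close>.\<close>
  have five: "\<not> (?c X Y = 2 \<and> ?c X Z = 2 \<and> ?c Y Z = 2 \<and> ?c X W = 2 \<and> ?c Y W = 2)"
    if "X \<in> \<C>" "Y \<in> \<C>" "Z \<in> \<C>" "W \<in> \<C>" "X \<noteq> Y" "X \<noteq> Z" "Y \<noteq> Z" "X \<noteq> W" "Y \<noteq> W" "Z \<noteq> W"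
      "\<Union>X \<subseteq> U" "\<Union>Y \<subseteq> U" "\<Union>Z \<subseteq> U" "\<Union>W \<subseteq> U" for X Y Z W
  proof -
    have "card (\<Union>X \<union> \<Union>Y \<union> \<Union>Z) \<le> 7" "card (\<Union>X \<union> \<Union>Y \<union> \<Union>W) \<le> 7"
      unfolding U(2)[symmetric]
      using card_mono[OF U(1) Un_least[OF Un_least[OF that(11,12)]]] that(13,14) by simp_all
    then show ?thesis
      using no_7_4_aux[OF that(1-10)] no by blast
  qed
  have "\<not> (?c A B = 2 \<and> ?c A D = 2 \<and> ?c B D = 2 \<and> ?c A E = 2 \<and> ?c B E = 2)"
    "\<not> (?c A B = 2 \<and> ?c A E = 2 \<and> ?c A D = 2 \<and> ?c B D = 2 \<and> ?c D E = 2)"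
    "\<not> (?c A B = 2 \<and> ?c A E = 2 \<and> ?c A D = 2 \<and> ?c B E = 2 \<and> ?c D E = 2)"
    "\<not> (?c A B = 2 \<and> ?c B D = 2 \<and> ?c A D = 2 \<and> ?c B E = 2 \<and> ?c D E = 2)"
    "\<not> (?c A B = 2 \<and> ?c B E = 2 \<and> ?c A E = 2 \<and> ?c B D = 2 \<and> ?c D E = 2)"
    "\<not> (?c A D = 2 \<and> ?c A E = 2 \<and> ?c B D = 2 \<and> ?c B E = 2 \<and> ?c D E = 2)"
    using five[OF mem neq(1,2,4,3,5,6) sub]
      five[OF mem(1,3,2,4) neq(2,1) neq(4)[symmetric] neq(3,6,5) sub(1,3,2,4)]
      five[OF mem(1,4,2,3) neq(3,1) neq(5)[symmetric] neq(2) neq(6)[symmetric] neq(4) sub(1,4,2,3)]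
      five[OF mem(2,3,1,4) neq(4) neq(1)[symmetric] neq(2)[symmetric] neq(5,6,3) sub(2,3,1,4)]
      five[OF mem(2,4,1,3) neq(5) neq(1)[symmetric] neq(3)[symmetric] neq(4) neq(6)[symmetric] neq(2) sub(2,4,1,3)]
      five[OF mem(3,4,1,2) neq(6) neq(2)[symmetric] neq(3)[symmetric] neq(4)[symmetric] neq(5)[symmetric] neq(1) sub(3,4,1,2)]
    unfolding Int_commute[of "\<Union>B" "\<Union>A"] Int_commute[of "\<Union>D" "\<Union>A"] Int_commute[of "\<Union>E" "\<Union>A"]
      Int_commute[of "\<Union>D" "\<Union>B"] Int_commute[of "\<Union>E" "\<Union>B"] Int_commute[of "\<Union>E" "\<Union>D"]
    by satx+
  then show False
    using five_of_six[OF sum le] by satx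
qed

end

section \<open>The necessary congruence\<close>

text \<open>Each cycle has 0 or 2 edges at a vertex, so v = 2k + 1. Then 4 divides k * (2k + 1),
  whose second factor is odd, and so 4 divides k.\<close>

lemma four_cycle_system_mod_8:
  fixes V :: "'a set"
  assumes "four_cycle_system v V \<C>" "v \<ge> 1"
  shows "v mod 8 = 1"
proof -
  have V: "finite V" "card V = v" and cyc: "\<And>X. X \<in> \<C> \<Longrightarrow> is_cycle4 X"
    and part: "partition_on (complete_edges V) \<C>"
    using assms(1) unfolding four_cycle_system_def by blast+
  have fin: "finite (complete_edges V)"
    unfolding complete_edges_def using V(1) by simp
  have fin_C: "finite \<C>"
    using finite_elements[OF fin part] .
  have disj: "\<And>X Y. X \<in> \<C> \<Longrightarrow> Y \<in> \<C> \<Longrightarrow> X \<noteq> Y \<Longrightarrow> X \<inter> Y = {}"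
    using part unfolding partition_on_def disjoint_def by blast
  have union: "\<Union>\<C> = complete_edges V"
    using part unfolding partition_on_def by blast
  have "card (complete_edges V) = (\<Sum>X\<in>\<C>. card X)"
    unfolding union[symmetric] using card_Union_disjoint[of \<C>] disj cyc finite_cycle4
    by (metis disjnt_def pairwiseI)
  also have "\<dots> = 4 * card \<C>"
    using card_cycle4[OF cyc] by simp
  finally have four: "v choose 2 = 4 * card \<C>"
    unfolding complete_edges_def using n_subsets[OF V(1)] V(2) by simp
  obtain x where x: "x \<in> V"
    using V assms(2) by (metis card.empty ex_in_conv not_one_le_zero)
  have star: "{e \<in> complete_edges V. x \<in> e} = (\<lambda>y. {x, y}) ` (V - {x})"
    unfolding complete_edges_def using x by (auto simp: card_2_iff)
  have "card {e \<in> complete_edges V. x \<in> e} = v - 1"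
    unfolding star using V x by (subst card_image) (auto simp: inj_on_def doubleton_eq_iff)
  moreover have "{e \<in> complete_edges V. x \<in> e} = (\<Union>X\<in>\<C>. {e \<in> X. x \<in> e})"
    unfolding union[symmetric] by blast
  moreover have "card (\<Union>X\<in>\<C>. {e \<in> X. x \<in> e}) = (\<Sum>X\<in>\<C>. card {e \<in> X. x \<in> e})"
    using fin_C finite_cycle4[OF cyc] disj by (intro card_UN_disjoint) auto
  moreover have "even (card {e \<in> X. x \<in> e})" if X_in: "X \<in> \<C>" for X
  proof -
    obtain a b c d where X: "distinct [a, b, c, d]" "X = cycle4 a b c d"
      using cyc[OF X_in] by (rule is_cycle4E)
    have filter: "{e \<in> insert A F. x \<in> e} = (if x \<in> A then insert A {e \<in> F. x \<in> e} else {e \<in> F. x \<in> e})"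
      for A and F :: "'a set set" by auto
    show ?thesis
      using X(1) unfolding X(2) cycle4_def filter
      by (cases "x = a"; cases "x = b"; cases "x = c"; cases "x = d"; auto simp: doubleton_eq_iff card_insert_if)
  qed
  then have "even (\<Sum>X\<in>\<C>. card {e \<in> X. x \<in> e})"
    by (rule dvd_sum)
  ultimately have "even (v - 1)"
    by metis
  then obtain k where k: "v = 2 * k + 1"
    using assms(2) by (metis evenE le_add_diff_inverse2)
  have "v choose 2 = (2 * k + 1) * k"
    unfolding k choose_two by simp
  then have "4 dvd (2 * k + 1) * k"
    using four by (metis dvd_triv_left)
  moreover have "coprime 4 (2 * k + 1)"
    using coprime_power_left_iff[of 2 2 "2 * k + 1"] by simp
  ultimately have "4 dvd k"
    using coprime_dvd_mult_right_iff by blast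
  then show ?thesis unfolding k by (auto elim!: dvdE)
qed

section \<open>Cyclic systems\<close>

lemma (in cycle4_packing) D_avoiding: "D_avoiding \<C>"
  unfolding D_avoiding_def
proof (intro notI)
  assume "\<exists>X\<in>\<C>. \<exists>Y\<in>\<C>. double_diamond X Y"
  then obtain X Y a b c d e f where XY: "X \<in> \<C>" "Y \<in> \<C>" "distinct [a, b, c, d, e, f]"
    "X = cycle4 a b c d" "Y = cycle4 a e c f"
    unfolding double_diamond_def by blast
  have "diagonal X a c" "diagonal Y a c"
    using XY(3) unfolding XY(4,5) diagonal_def by (auto simp: edge_cycle4_iff)
  then have "X = Y"
    using diagonal_disjoint XY(1,2) by blast
  moreover have "{a, b} \<in> X" "{a, b} \<notin> Y"
    using XY(3) unfolding XY(4,5) edge_cycle4_iff by auto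
  ultimately show False by simp
qed

text \<open>Any overlap would make the union bound strict.\<close>

lemma disjoint_if_card_Union_ge:
  assumes "finite F" "\<And>X. X \<in> F \<Longrightarrow> finite X \<and> card X = k" "k * card F \<le> card (\<Union>F)"
    and "X \<in> F" "Y \<in> F" "X \<noteq> Y"
  shows "X \<inter> Y = {}"
proof (rule ccontr)
  assume "X \<inter> Y \<noteq> {}"
  then have "card (X \<inter> Y) > 0"
    using assms(2,4) by (simp add: card_gt_0_iff)
  then have XY: "card (X \<union> Y) < 2 * k"
    using card_Un_Int[of X Y] assms(2,4,5) by simp
  have "card (\<Union>(F - {X, Y})) \<le> (\<Sum>Z\<in>F - {X, Y}. card Z)"
    by (rule card_Union_le_sum_card)
  also have "\<dots> = k * card (F - {X, Y})"
    using assms(2) by simp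
  also have "\<dots> = k * (card F - 2)"
    using assms(4-6) by (simp add: card_Diff_subset numeral_2_eq_2)
  finally have rest: "card (\<Union>(F - {X, Y})) \<le> k * (card F - 2)" .
  have "card {X, Y} \<le> card F"
    using assms by (intro card_mono) auto
  then have "2 \<le> card F" using assms(6) by simp
  then have "k * (card F - 2) + 2 * k = k * card F"
    by (simp add: diff_mult_distrib2)
  moreover have "\<Union>F = (X \<union> Y) \<union> \<Union>(F - {X, Y})"
    using assms(4,5) by auto
  then have "card (\<Union>F) \<le> card (X \<union> Y) + card (\<Union>(F - {X, Y}))"
    using card_Un_le by metis
  ultimately show False
    using XY rest assms(3) by linarith
qed

text \<open>Edge-disjointness comes for free: the cycles cover all edges and are too few to cover
  any edge twice.\<close>

lemma four_cycle_systemI: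
  assumes "finite V" "finite \<C>" "\<And>X. X \<in> \<C> \<Longrightarrow> is_cycle4 X" "\<And>X. X \<in> \<C> \<Longrightarrow> \<Union>X \<subseteq> V"
    and "\<And>x y. x \<in> V \<Longrightarrow> y \<in> V \<Longrightarrow> x \<noteq> y \<Longrightarrow> \<exists>X\<in>\<C>. {x, y} \<in> X"
    and "4 * card \<C> \<le> card V choose 2"
  shows "four_cycle_system (card V) V \<C>"
proof -
  have edges: "\<Union>\<C> = complete_edges V"
  proof (intro equalityI subsetI)
    fix e assume "e \<in> \<Union>\<C>"
    then obtain X where X: "X \<in> \<C>" "e \<in> X" by blast
    obtain a b c d where "distinct [a, b, c, d]" "X = cycle4 a b c d"
      using assms(3)[OF X(1)] by (rule is_cycle4E)
    then have "card e = 2"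
      using X(2) unfolding cycle4_def by auto
    then show "e \<in> complete_edges V"
      using X assms(4) unfolding complete_edges_def by blast
  next
    fix e assume "e \<in> complete_edges V"
    then obtain x y where "e = {x, y}" "x \<noteq> y" "x \<in> V" "y \<in> V"
      unfolding complete_edges_def by (auto simp: card_2_iff)
    then show "e \<in> \<Union>\<C>" using assms(5) by blast
  qed
  have "card (\<Union>\<C>) = card V choose 2"
    unfolding edges complete_edges_def using n_subsets[OF assms(1)] .
  then have "X \<inter> Y = {}" if "X \<in> \<C>" "Y \<in> \<C>" "X \<noteq> Y" for X Y
    using disjoint_if_card_Union_ge[OF assms(2) _ _ that] assms(3,6) card_cycle4 finite_cycle4 by metis
  moreover have "{} \<notin> \<C>"
    using assms(3) card_cycle4 by force
  ultimately have "partition_on (complete_edges V) \<C>"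
    unfolding partition_on_def disjoint_def edges by blast
  then show ?thesis
    unfolding four_cycle_system_def using assms(1,3) by blast
qed

locale cyclic_base =
  fixes n :: nat and Q :: "(int \<times> int \<times> int \<times> int) set"
begin

abbreviation v :: int where "v \<equiv> 8 * int n + 1"

text \<open>The residue of least absolute value, unique because the modulus is odd.\<close>

definition center :: "int \<Rightarrow> int" where
  "center z = (z + 4 * int n) mod v - 4 * int n"

lemma center_eq: "\<bar>z - v * k\<bar> \<le> 4 * int n \<Longrightarrow> center z = z - v * k"
proof -
  assume *: "\<bar>z - v * k\<bar> \<le> 4 * int n"
  have "(z + 4 * int n) mod v = (z - v * k + 4 * int n) mod v"
    by (simp add: mod_eq_dvd_iff)
  also have "\<dots> = z - v * k + 4 * int n"
    using * by (intro mod_pos_pos_trivial) linarith+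
  finally show ?thesis unfolding center_def by simp
qed

lemma center_bounded: "\<bar>center z\<bar> \<le> 4 * int n"
  using pos_mod_sign[of v "z + 4 * int n"] pos_mod_bound[of v "z + 4 * int n"]
  unfolding center_def by linarith

lemma center_cong: "v dvd z - center z"
  unfolding center_def by (metis add_diff_eq diff_diff_eq2 minus_mod_eq_mult_div dvd_triv_left)

text \<open>Seen from a vertex, \<open>t\<close> leads to a neighbour and \<open>u\<close> to the
  opposite vertex. Four vertices with two neighbours each give eight pairs per base cycle. By
  translation invariance this describes \<open>opposite\<close> at every vertex at once.\<close>

definition turns :: "(int \<times> int) set" where
  "turns = {(t, u). \<exists>a b c d. (a, b, c, d) \<in> Q \<and>
     (t, u) \<in> {(a, center (a + b)), (- d, center (a + b)), (b, center (b + c)), (- a, center (b + c)),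
       (c, - center (a + b)), (- b, - center (a + b)), (d, - center (b + c)), (- c, - center (b + c))}}"

definition vertex :: "int \<Rightarrow> nat" where
  "vertex z = nat (z mod v)"

fun translate :: "int \<times> int \<times> int \<times> int \<Rightarrow> int \<Rightarrow> nat set set" where
  "translate (a, b, c, d) k = cycle4 (vertex k) (vertex (k + a)) (vertex (k + a + b)) (vertex (k + a + b + c))"

definition system :: "nat set set set" where
  "system = {translate q k | q k. q \<in> Q}"

end

text \<open>At most \<open>n\<close> base cycles with four differences each cover 4n differences, so
  none repeats. The last three conditions make all diagonal differences distinct up to sign, which
  excludes double diamonds.\<close>

locale cyclic_sparse_base = cyclic_base +
  assumes finite_base: "finite Q" and card_base: "card Q \<le> n"
    and sum_zero: "(a, b, c, d) \<in> Q \<Longrightarrow> a + b + c + d = 0"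
    and bounded: "(a, b, c, d) \<in> Q \<Longrightarrow> w \<in> {a, b, c, d} \<Longrightarrow> \<bar>w\<bar> \<le> 4 * int n"
    and nonzero: "(a, b, c, d) \<in> Q \<Longrightarrow> w \<in> {a, b, c, d, center (a + b), center (b + c)} \<Longrightarrow> w \<noteq> 0"
    and covered: "1 \<le> z \<Longrightarrow> z \<le> 4 * int n \<Longrightarrow> \<exists>(a, b, c, d)\<in>Q. z \<in> {a, b, c, d} \<or> - z \<in> {a, b, c, d}"
    and diagonal_1: "(a, b, c, d) \<in> Q \<Longrightarrow> (a', b', c', d') \<in> Q \<Longrightarrow>
      \<bar>center (a + b)\<bar> = \<bar>center (a' + b')\<bar> \<Longrightarrow> (a, b, c, d) = (a', b', c', d')"
    and diagonal_2: "(a, b, c, d) \<in> Q \<Longrightarrow> (a', b', c', d') \<in> Q \<Longrightarrow>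
      \<bar>center (b + c)\<bar> = \<bar>center (b' + c')\<bar> \<Longrightarrow> (a, b, c, d) = (a', b', c', d')"
    and diagonal_12: "(a, b, c, d) \<in> Q \<Longrightarrow> (a', b', c', d') \<in> Q \<Longrightarrow>
      \<bar>center (a + b)\<bar> \<noteq> \<bar>center (b' + c')\<bar>"
begin

lemma vertex_eq_iff: "vertex x = vertex y \<longleftrightarrow> v dvd x - y"
  unfolding vertex_def by (simp add: mod_eq_dvd_iff[symmetric] eq_nat_nat_iff)

lemma dvd_small: "v dvd w \<Longrightarrow> \<bar>w\<bar> \<le> 8 * int n \<Longrightarrow> w = 0"
  using zdvd_imp_le[of v "\<bar>w\<bar>"] by fastforce

lemma vertex_add_eq_iff: "\<bar>s - t\<bar> \<le> 8 * int n \<Longrightarrow> vertex (x + s) = vertex (x + t) \<longleftrightarrow> s = t"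
  unfolding vertex_eq_iff using dvd_small[of "s - t"] by auto

lemma vertex_shift: "vertex x = vertex y \<Longrightarrow> vertex (x + z) = vertex (y + z)"
  by (simp add: vertex_eq_iff)

lemma vertex_center: "vertex (x + center z) = vertex (x + z)" "vertex (x + - center z) = vertex (x - z)"
  using center_cong[of z] unfolding vertex_eq_iff by (auto simp: dvd_diff_commute algebra_simps)

lemma translate_shift:
  assumes "vertex k = vertex k'"
  shows "translate q k = translate q k'"
proof -
  obtain a b c d where q: "q = (a, b, c, d)" by (cases q)
  show ?thesis
    unfolding q translate.simps
    using assms vertex_shift[OF assms, of a] vertex_shift[OF assms, of "a + b"] vertex_shift[OF assms, of "a + b + c"]
    by (simp add: add.assoc)
qed

lemma distinct_translate:
  assumes "(a, b, c, d) \<in> Q"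
  shows "distinct [vertex k, vertex (k + a), vertex (k + a + b), vertex (k + a + b + c)]"
proof -
  have *: "vertex x \<noteq> vertex y" if "y = x + w" "center w \<noteq> 0" for x y w
    using vertex_add_eq_iff[of 0 "center w" x] vertex_center(1)[of x w] center_bounded[of w] that by auto
  have self: "center w = w" if "\<bar>w\<bar> \<le> 4 * int n" for w
    using center_eq[of w 0] that by simp
  have d: "a + b + c = - d" using sum_zero[OF assms] by linarith
  have nz: "center a \<noteq> 0" "center b \<noteq> 0" "center c \<noteq> 0" "center (a + b + c) \<noteq> 0"
    "center (a + b) \<noteq> 0" "center (b + c) \<noteq> 0"
    unfolding d
    using self[OF bounded[OF assms, of a]] self[OF bounded[OF assms, of b]] self[OF bounded[OF assms, of c]]
      self[of "- d"] bounded[OF assms, of d] nonzero[OF assms, of a] nonzero[OF assms, of b]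
      nonzero[OF assms, of c] nonzero[OF assms, of d] nonzero[OF assms, of "center (a + b)"]
      nonzero[OF assms, of "center (b + c)"]
    by simp_all
  show ?thesis
    using *[of "k + a" k, OF _ nz(1)] *[of "k + a + b" k, OF _ nz(5)]
      *[of "k + a + b + c" k, OF _ nz(4)] *[of "k + a + b" "k + a", OF _ nz(2)]
      *[of "k + a + b + c" "k + a", OF _ nz(6)] *[of "k + a + b + c" "k + a + b", OF _ nz(3)]
    by (simp add: add.assoc)
qed

lemma systemE:
  assumes "X \<in> system"
  obtains a b c d k where "(a, b, c, d) \<in> Q" "X = translate (a, b, c, d) k"
proof -
  obtain q k where "q \<in> Q" "X = translate q k"
    using assms unfolding system_def by blast
  then show ?thesis
    by (cases q) (use that in blast)
qed

lemma translate_is_cycle4: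
  assumes "X \<in> system"
  shows "is_cycle4 X"
proof -
  obtain a b c d k where "(a, b, c, d) \<in> Q" "X = translate (a, b, c, d) k"
    using assms by (rule systemE)
  then show ?thesis
    unfolding is_cycle4_def translate.simps using distinct_translate by blast
qed

lemma vertex_less: "vertex z < 8 * n + 1"
  using pos_mod_bound[of v z] unfolding vertex_def by linarith

lemma Union_translate: "X \<in> system \<Longrightarrow> \<Union>X \<subseteq> {..<8 * n + 1}"
proof (elim systemE)
  fix a b c d k assume X: "X = translate (a, b, c, d) k"
  show "\<Union>X \<subseteq> {..<8 * n + 1}"
    unfolding X translate.simps Union_cycle4 using vertex_less by blast
qed

lemma system_eq: "system = (\<lambda>(q, k). translate q k) ` (Q \<times> {0..<v})"
proof (intro equalityI subsetI)
  fix X assume "X \<in> system"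
  then obtain q k where X: "X = translate q k" "q \<in> Q" unfolding system_def by blast
  have "translate q k = translate q (k mod v)"
    by (rule translate_shift) (simp add: vertex_def)
  moreover have "k mod v \<in> {0..<v}"
    using pos_mod_sign[of v k] pos_mod_bound[of v k] by simp
  ultimately show "X \<in> (\<lambda>(q, k). translate q k) ` (Q \<times> {0..<v})"
    using X by (intro image_eqI[of _ _ "(q, k mod v)"]) simp_all
qed (auto simp: system_def simp del: translate.simps split_paired_Ex)

lemma edge_in_system:
  assumes "(a, b, c, d) \<in> Q" "w \<in> {a, b, c, d}"
  shows "\<exists>X\<in>system. {vertex x, vertex (x + w)} \<in> X"
proof -
  have d: "d = - (a + b + c)" using sum_zero[OF assms(1)] by simp
  have "{vertex x, vertex (x + a)} \<in> translate (a, b, c, d) x"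
    "{vertex x, vertex (x + b)} \<in> translate (a, b, c, d) (x - a)"
    "{vertex x, vertex (x + c)} \<in> translate (a, b, c, d) (x - a - b)"
    "{vertex x, vertex (x + d)} \<in> translate (a, b, c, d) (x - a - b - c)"
    unfolding d by (simp_all add: edge_cycle4_iff algebra_simps)
  then show ?thesis
    using assms unfolding system_def by blast
qed

lemma system_covers:
  assumes "x \<in> {..<8 * n + 1}" "y \<in> {..<8 * n + 1}" "x \<noteq> y"
  shows "\<exists>X\<in>system. {x, y} \<in> X"
proof -
  have close: "\<exists>X\<in>system. {vertex x, vertex (x + z)} \<in> X" if z: "1 \<le> z" "z \<le> 4 * int n" for x z
  proof -
    obtain a b c d where abcd: "(a, b, c, d) \<in> Q" "z \<in> {a, b, c, d} \<or> - z \<in> {a, b, c, d}"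
      using covered[OF z] by auto
    show ?thesis
      using abcd(2) edge_in_system[OF abcd(1), of z x] edge_in_system[OF abcd(1), of "- z" "x + z"]
      by (auto simp: insert_commute)
  qed
  have main: "\<exists>X\<in>system. {x, y} \<in> X" if "x < y" "y < 8 * n + 1" for x y
  proof -
    have xy: "vertex (int x) = x" "vertex (int y) = y"
      using that unfolding vertex_def by simp_all
    show ?thesis
    proof (cases "y - x \<le> 4 * n")
      case True
      then have "1 \<le> int y - int x" "int y - int x \<le> 4 * int n"
        using that by linarith+
      from close[OF this, of "int x"] show ?thesis
        by (simp add: xy)
    next
      case False
      \<comment> \<open>A long difference becomes short when measured from \<open>y\<close> around
        to \<open>x\<close>.\<close>
      then have "1 \<le> v - (int y - int x)" "v - (int y - int x) \<le> 4 * int n"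
        using that by linarith+
      note close[OF this, of "int y"]
      moreover have "vertex (int y + (v - (int y - int x))) = vertex (int x)"
        unfolding vertex_eq_iff by simp
      ultimately show ?thesis
        by (simp only: xy insert_commute[of x y])
    qed
  qed
  show ?thesis
  proof (cases "x < y")
    case True
    then show ?thesis using main assms(2) by simp
  next
    case False
    then have "y < x" "x < 8 * n + 1" using assms(1,3) by simp_all
    then show ?thesis
      unfolding insert_commute[of x y] by (rule main)
  qed
qed

lemma four_cycle_system: "four_cycle_system (8 * n + 1) {..<8 * n + 1} system"
proof -
  have fin: "finite system"
    unfolding system_eq using finite_base by simp
  have "card system \<le> card (Q \<times> {0..<v})"
    unfolding system_eq using finite_base by (intro card_image_le) simp
  also have "\<dots> = card Q * (8 * n + 1)"
    by (simp add: card_cartesian_product nat_add_distrib nat_mult_distrib)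
  also have "\<dots> \<le> n * (8 * n + 1)"
    using card_base by (rule mult_right_mono) simp
  \<comment> \<open>The bound is sharp: 4 * n * (8 * n + 1) is exactly the number of edges.\<close>
  finally have "4 * card system \<le> (8 * n + 1) choose 2"
    by (simp add: choose_two algebra_simps)
  then show ?thesis
    using four_cycle_systemI[of "{..<8 * n + 1}" system] fin translate_is_cycle4 Union_translate system_covers
    by simp
qed

text \<open>The difference \<open>t\<close> of a diagonal is paired with the offset \<open>s\<close>
  of its first vertex, since \<open>t\<close> will turn out to determine \<open>s\<close>.\<close>

lemma diagonalE:
  assumes "X \<in> system" "diagonal X x z"
  obtains a b c d k t s where "(a, b, c, d) \<in> Q" "X = translate (a, b, c, d) k"
    "(t, s) \<in> {(center (a + b), 0), (- center (a + b), a + b),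
      (center (b + c), a), (- center (b + c), a + b + c)}"
    "x = vertex (k + s)" "z = vertex (k + s + t)"
proof -
  obtain a b c d k where q: "(a, b, c, d) \<in> Q" "X = translate (a, b, c, d) k"
    using assms(1) by (rule systemE)
  from assms(2) show ?thesis
    unfolding q(2) translate.simps diagonal_cycle4_iff[OF distinct_translate[OF q(1)]]
  proof (elim disjE conjE)
    assume "x = vertex k" "z = vertex (k + a + b)"
    then show ?thesis
      using that[OF q, of "center (a + b)" 0]
      unfolding vertex_center by (simp add: algebra_simps)
  next
    assume "x = vertex (k + a + b)" "z = vertex k"
    then show ?thesis
      using that[OF q, of "- center (a + b)" "a + b"]
      unfolding vertex_center by (simp add: algebra_simps)
  next
    assume "x = vertex (k + a)" "z = vertex (k + a + b + c)"
    then show ?thesis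
      using that[OF q, of "center (b + c)" a]
      unfolding vertex_center by (simp add: algebra_simps)
  next
    assume "x = vertex (k + a + b + c)" "z = vertex (k + a)"
    then show ?thesis
      using that[OF q, of "- center (b + c)" "a + b + c"]
      unfolding vertex_center by (simp add: algebra_simps)
  qed
qed

text \<open>The ends of a diagonal determine its centered difference; by distinctness this
  determines the base cycle and then, with its sign, the offset, so the translate is determined
  too.\<close>

sublocale cycle4_packing system
proof
  show "is_cycle4 X" if "X \<in> system" for X
    using translate_is_cycle4[OF that] .
  show "X = Y" if "X \<in> system" "Y \<in> system" "e \<in> X" "e \<in> Y" for X Y e
    using four_cycle_system that unfolding four_cycle_system_def partition_on_def disjoint_def by blast
  fix X Y x z assume "X \<in> system" "Y \<in> system" "diagonal X x z" "diagonal Y x z"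
  then obtain a b c d k t s a' b' c' d' k' t' s' where
    X: "(a, b, c, d) \<in> Q" "X = translate (a, b, c, d) k"
      "(t, s) \<in> {(center (a + b), 0), (- center (a + b), a + b),
      (center (b + c), a), (- center (b + c), a + b + c)}"
      "x = vertex (k + s)" "z = vertex (k + s + t)" and
    Y: "(a', b', c', d') \<in> Q" "Y = translate (a', b', c', d') k'"
      "(t', s') \<in> {(center (a' + b'), 0), (- center (a' + b'), a' + b'),
        (center (b' + c'), a'), (- center (b' + c'), a' + b' + c')}"
      "x = vertex (k' + s')" "z = vertex (k' + s' + t')"
    by (elim diagonalE) blast
  have "t \<in> {center (a + b), - center (a + b), center (b + c), - center (b + c)}"
    "t' \<in> {center (a' + b'), - center (a' + b'), center (b' + c'), - center (b' + c')}"
    using X(3) Y(3) by auto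
  then have "\<bar>t\<bar> \<le> 4 * int n" "\<bar>t'\<bar> \<le> 4 * int n"
    using center_bounded by auto
  then have "\<bar>t - t'\<bar> \<le> 8 * int n"
    by linarith
  moreover have "vertex (k + s + t) = vertex (k + s + t')"
    using vertex_shift[of "k + s" "k' + s'" t'] X(4,5) Y(4,5) by simp
  ultimately have t: "t = t'"
    using vertex_add_eq_iff by blast
  have "\<bar>t\<bar> = \<bar>center (a + b)\<bar> \<or> \<bar>t\<bar> = \<bar>center (b + c)\<bar>"
    "\<bar>t\<bar> = \<bar>center (a' + b')\<bar> \<or> \<bar>t\<bar> = \<bar>center (b' + c')\<bar>"
    using X(3) Y(3) unfolding t by auto
  then have q: "(a, b, c, d) = (a', b', c', d')"
    using diagonal_1[OF X(1) Y(1)] diagonal_2[OF X(1) Y(1)] diagonal_12[OF X(1) Y(1)]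
      diagonal_12[OF Y(1) X(1)] by metis
  have neq: "center (a + b) \<noteq> 0" "center (b + c) \<noteq> 0" "center (a + b) \<noteq> center (b + c)"
    "center (a + b) \<noteq> - center (b + c)"
    using nonzero[OF X(1)] diagonal_12[OF X(1) X(1)] by auto
  have "(t, s') \<in> {(center (a + b), 0), (- center (a + b), a + b),
      (center (b + c), a), (- center (b + c), a + b + c)}"
    using Y(3) q unfolding t by simp
  moreover have "s = s'"
    if "(t, s) \<in> {(S, 0), (- S, o1), (T, o2), (- T, o3)}" "(t, s') \<in> {(S, 0), (- S, o1), (T, o2), (- T, o3)}"
      "S \<noteq> 0" "T \<noteq> 0" "S \<noteq> T" "S \<noteq> - T" for S T o1 o2 o3 :: int
    using that by auto
  ultimately have "s = s'"
    using X(3) neq by blast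
  then have "vertex k = vertex k'"
    using vertex_shift[of "k + s" "k' + s'" "- s"] X(4) Y(4) by simp
  then show "X = Y"
    unfolding X(2) Y(2) q by (rule translate_shift)
qed

lemma turns_bounded:
  assumes "(t, u) \<in> turns"
  shows "\<bar>t\<bar> \<le> 4 * int n" "\<bar>u\<bar> \<le> 4 * int n"
proof -
  obtain a b c d where q: "(a, b, c, d) \<in> Q" and
    tu: "(t, u) \<in> {(a, center (a + b)), (- d, center (a + b)), (b, center (b + c)), (- a, center (b + c)),
       (c, - center (a + b)), (- b, - center (a + b)), (d, - center (b + c)), (- c, - center (b + c))}"
    using assms unfolding turns_def mem_Collect_eq case_prod_conv by blast
  have "t \<in> {a, b, c, d} \<or> - t \<in> {a, b, c, d}" "\<bar>u\<bar> = \<bar>center (a + b)\<bar> \<or> \<bar>u\<bar> = \<bar>center (b + c)\<bar>"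
    using tu by (elim insertE emptyE; simp)+
  then show "\<bar>t\<bar> \<le> 4 * int n" "\<bar>u\<bar> \<le> 4 * int n"
    using bounded[OF q, of t] bounded[OF q, of "- t"] center_bounded[of "a + b"] center_bounded[of "b + c"]
    by (auto simp del: add_uminus_conv_diff)
qed

lemma oppositeE:
  assumes "opposite x y z"
  obtains s t u where "(t, u) \<in> turns" "x = vertex s" "y = vertex (s + t)" "z = vertex (s + u)"
proof -
  obtain X where X: "X \<in> system" "{x, y} \<in> X" "diagonal X x z"
    using assms unfolding opposite_def by blast
  obtain a b c d k where q: "(a, b, c, d) \<in> Q" "X = translate (a, b, c, d) k"
    using X(1) by (rule systemE)
  have d: "d = - (a + b + c)" using sum_zero[OF q(1)] by simp
  have turn: "(t, u) \<in> turns"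
    if "(t, u) \<in> {(a, center (a + b)), (- d, center (a + b)), (b, center (b + c)), (- a, center (b + c)),
       (c, - center (a + b)), (- b, - center (a + b)), (d, - center (b + c)), (- c, - center (b + c))}" for t u
    unfolding turns_def mem_Collect_eq case_prod_conv using q(1) that by blast
  define p where "p = vertex k"
  define p1 where "p1 = vertex (k + a)"
  define p2 where "p2 = vertex (k + a + b)"
  define p3 where "p3 = vertex (k + a + b + c)"
  have dist: "distinct [p, p1, p2, p3]" and X_eq: "X = cycle4 p p1 p2 p3"
    unfolding p_def p1_def p2_def p3_def using distinct_translate[OF q(1)] q(2) by simp_all
  have "x = p \<and> y = p1 \<and> z = p2 \<or> x = p \<and> y = p3 \<and> z = p2 \<or> x = p1 \<and> y = p2 \<and> z = p3 \<or>
    x = p1 \<and> y = p \<and> z = p3 \<or> x = p2 \<and> y = p3 \<and> z = p \<or> x = p2 \<and> y = p1 \<and> z = p \<or>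
    x = p3 \<and> y = p \<and> z = p1 \<or> x = p3 \<and> y = p2 \<and> z = p1"
    using X(2,3) dist unfolding X_eq diagonal_cycle4_iff[OF dist] edge_cycle4_iff by auto
  then show ?thesis
  proof (elim disjE conjE)
    assume "x = p" "y = p1" "z = p2"
    then show ?thesis
      using that[OF turn[of a "center (a + b)"], of k]
      unfolding vertex_center by (simp add: p_def p1_def p2_def algebra_simps)
  next
    assume "x = p" "y = p3" "z = p2"
    then show ?thesis
      using that[OF turn[of "- d" "center (a + b)"], of k]
      unfolding vertex_center by (simp add: p_def p3_def p2_def d algebra_simps)
  next
    assume "x = p1" "y = p2" "z = p3"
    then show ?thesis
      using that[OF turn[of b "center (b + c)"], of "k + a"]
      unfolding vertex_center by (simp add: p1_def p2_def p3_def algebra_simps)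
  next
    assume "x = p1" "y = p" "z = p3"
    then show ?thesis
      using that[OF turn[of "- a" "center (b + c)"], of "k + a"]
      unfolding vertex_center by (simp add: p_def p1_def p3_def algebra_simps)
  next
    assume "x = p2" "y = p3" "z = p"
    then show ?thesis
      using that[OF turn[of c "- center (a + b)"], of "k + a + b"]
      unfolding vertex_center by (simp add: p_def p2_def p3_def algebra_simps)
  next
    assume "x = p2" "y = p1" "z = p"
    then show ?thesis
      using that[OF turn[of "- b" "- center (a + b)"], of "k + a + b"]
      unfolding vertex_center by (simp add: p_def p1_def p2_def algebra_simps)
  next
    assume "x = p3" "y = p" "z = p1"
    then show ?thesis
      using that[OF turn[of d "- center (b + c)"], of "k + a + b + c"]
      unfolding vertex_center by (simp add: p_def p1_def p3_def d algebra_simps)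
  next
    assume "x = p3" "y = p2" "z = p1"
    then show ?thesis
      using that[OF turn[of "- c" "- center (b + c)"], of "k + a + b + c"]
      unfolding vertex_center by (simp add: p1_def p2_def p3_def algebra_simps)
  qed
qed

text \<open>The three steps come with different representatives of \<open>x\<close>. Their
  differences are at most \<open>4 * int n\<close> in absolute value, so congruent ones are equal
  and the steps chain.\<close>

lemma three_periodicE:
  assumes "three_periodic x p"
  obtains s t u w where "x = vertex s" "p = vertex (s + t)" "(t, u) \<in> turns" "(u, w) \<in> turns" "(w, t) \<in> turns"
proof -
  obtain q r where "opposite x p q" "opposite x q r" "opposite x r p"
    using assms unfolding three_periodic_def by blast
  then obtain s1 t1 u1 s2 t2 u2 s3 t3 u3 where
    1: "(t1, u1) \<in> turns" "x = vertex s1" "p = vertex (s1 + t1)" "q = vertex (s1 + u1)" and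
    2: "(t2, u2) \<in> turns" "x = vertex s2" "q = vertex (s2 + t2)" "r = vertex (s2 + u2)" and
    3: "(t3, u3) \<in> turns" "x = vertex s3" "r = vertex (s3 + t3)" "p = vertex (s3 + u3)"
    by (elim oppositeE) blast
  have eq: "a = b" if "vertex (s + a) = vertex (s' + b)" "vertex s = vertex s'" "(a, a') \<in> turns" "(b', b) \<in> turns"
    for a a' b b' s s'
  proof -
    have "vertex (s + a) = vertex (s + b)"
      using that(1) vertex_shift[OF that(2), of b] by simp
    moreover have "\<bar>a - b\<bar> \<le> 8 * int n"
      using turns_bounded[OF that(3)] turns_bounded[OF that(4)] by linarith
    ultimately show ?thesis
      using vertex_add_eq_iff by blast
  qed
  have "t2 = u1" "t3 = u2" "t1 = u3"
    using eq[of s2 t2 s1 u1] eq[of s3 t3 s2 u2] eq[of s1 t1 s3 u3] 1 2 3 by auto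
  then show ?thesis
    using that[of s1 t1 u1 u2] 1 2 3 by simp
qed

lemma strictly_sparse_system:
  assumes "\<And>t u w u' w'. (t, u) \<in> turns \<Longrightarrow> (u, w) \<in> turns \<Longrightarrow> (w, t) \<in> turns \<Longrightarrow>
    (- t, u') \<in> turns \<Longrightarrow> (u', w') \<in> turns \<Longrightarrow> (w', - t) \<in> turns \<Longrightarrow> False"
  shows "strictly_sparse 4 system"
  unfolding strictly_sparse_def
proof (intro conjI sparse_4_if_no_7_4 no_7_4 D_avoiding notI)
  fix x y assume "three_periodic x y \<and> three_periodic y x"
  then obtain s t u w s' t' u' w' where
    1: "x = vertex s" "y = vertex (s + t)" "(t, u) \<in> turns" "(u, w) \<in> turns" "(w, t) \<in> turns" and
    2: "y = vertex s'" "x = vertex (s' + t')" "(t', u') \<in> turns" "(u', w') \<in> turns" "(w', t') \<in> turns"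
    by (elim conjE three_periodicE) blast
  have "vertex (s + 0) = vertex (s + (t + t'))"
    using vertex_shift[of "s + t" s' t'] 1(1,2) 2(1,2) by (simp add: add.assoc)
  moreover have "\<bar>0 - (t + t')\<bar> \<le> 8 * int n"
    using turns_bounded[OF 1(3)] turns_bounded[OF 2(3)] by linarith
  ultimately have "0 = t + t'"
    using vertex_add_eq_iff by blast
  then have "t' = - t" by simp
  then show False
    using assms[OF 1(3-5)] 2(3-5) by blast
qed

end

section \<open>Base cycles in arithmetic progressions\<close>

text \<open>
  A tuple \<open>(a, b, c, d, S, T, L)\<close> stands for the \<open>L\<close> base cycles
  \<open>(a + i, b + i, c + i, d - 3 * i)\<close>, whose diagonals have centered differences
  \<open>S + 2 * i\<close> and \<open>T + 2 * i\<close>.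
\<close>

type_synonym family = "int \<times> int \<times> int \<times> int \<times> int \<times> int \<times> int"

fun members :: "family \<Rightarrow> (int \<times> int \<times> int \<times> int) set" where
  "members (a, b, c, d, S, T, L) = (\<lambda>i. (a + i, b + i, c + i, d - 3 * i)) ` {0..<L}"

fun family_size :: "family \<Rightarrow> int" where
  "family_size (a, b, c, d, S, T, L) = L"

fun covers :: "family \<Rightarrow> int \<Rightarrow> int \<Rightarrow> bool" where
  "covers (a, b, c, d, S, T, L) i z \<longleftrightarrow> 0 \<le> i \<and> i < L \<and> z \<in> {\<bar>a + i\<bar>, \<bar>b + i\<bar>, \<bar>c + i\<bar>, \<bar>d - 3 * i\<bar>}"

text \<open>The eight pairs of \<open>turns\<close>, in the same order, with the index
  \<open>i\<close> eliminated in favour of \<open>t\<close>. Equations for the entries of step 3 are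
  multiplied by 3, which also encodes the divisibility of \<open>t + d\<close> or
  \<open>t - d\<close>. Here \<open>n\<close> is the first label of the family.\<close>

fun arc :: "family \<Rightarrow> nat \<Rightarrow> nat \<Rightarrow> int \<Rightarrow> int \<Rightarrow> bool" where
  "arc (a, b, c, d, S, T, L) n k t u \<longleftrightarrow>
     k = n \<and> a \<le> t \<and> t < a + L \<and> u = S + 2 * (t - a) \<or>
     k = n + 1 \<and> - d \<le> t \<and> t \<le> 3 * (L - 1) - d \<and> 3 * u = 3 * S + 2 * (t + d) \<or>
     k = n + 2 \<and> b \<le> t \<and> t < b + L \<and> u = T + 2 * (t - b) \<or>
     k = n + 3 \<and> a \<le> - t \<and> - t < a + L \<and> u = T - 2 * (t + a) \<or>
     k = n + 4 \<and> c \<le> t \<and> t < c + L \<and> u = - S - 2 * (t - c) \<or>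
     k = n + 5 \<and> b \<le> - t \<and> - t < b + L \<and> u = 2 * (t + b) - S \<or>
     k = n + 6 \<and> t \<le> d \<and> d - t \<le> 3 * (L - 1) \<and> 3 * u = 2 * (t - d) - 3 * T \<or>
     k = n + 7 \<and> c \<le> - t \<and> - t < c + L \<and> u = 2 * (t + c) - T"

fun arcs :: "family list \<Rightarrow> nat \<Rightarrow> nat \<Rightarrow> int \<Rightarrow> int \<Rightarrow> bool" where
  "arcs [] n k t u \<longleftrightarrow> False"
| "arcs (f # fs) n k t u \<longleftrightarrow> arc f n k t u \<or> arcs fs (n + 8) k t u"

text \<open>One multiple of the modulus serves a whole family in \<open>diagonals\<close>, so
  centering disappears and the conditions on each family become linear up to absolute
  values.\<close>

locale base_families =
  fixes n :: nat and fs :: "family list"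
  assumes size_sum: "(\<Sum>f\<leftarrow>fs. nat (family_size f)) \<le> n"
    and sum_zero: "(a, b, c, d, S, T, L) \<in> set fs \<Longrightarrow> a + b + c + d = 0"
    and diagonals: "(a, b, c, d, S, T, L) \<in> set fs \<Longrightarrow>
      S - (a + b) \<in> {0, 8 * int n + 1, - (8 * int n + 1)} \<and> T - (b + c) \<in> {0, 8 * int n + 1, - (8 * int n + 1)}"
    and range: "(a, b, c, d, S, T, L) \<in> set fs \<Longrightarrow> 0 \<le> i \<Longrightarrow> i < L \<Longrightarrow>
      w \<in> {a + i, b + i, c + i, d - 3 * i, S + 2 * i, T + 2 * i} \<Longrightarrow> w \<noteq> 0 \<and> \<bar>w\<bar> \<le> 4 * int n"
    and covered: "1 \<le> z \<Longrightarrow> z \<le> 4 * int n \<Longrightarrow> \<exists>f\<in>set fs. \<exists>i. covers f i z"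
    and diagonal_1: "(a, b, c, d, S, T, L) \<in> set fs \<Longrightarrow> (a', b', c', d', S', T', L') \<in> set fs \<Longrightarrow>
      0 \<le> i \<Longrightarrow> i < L \<Longrightarrow> 0 \<le> j \<Longrightarrow> j < L' \<Longrightarrow> \<bar>S + 2 * i\<bar> = \<bar>S' + 2 * j\<bar> \<Longrightarrow> a + i = a' + j \<and> b + i = b' + j \<and> c + i = c' + j \<and> d - 3 * i = d' - 3 * j"
    and diagonal_2: "(a, b, c, d, S, T, L) \<in> set fs \<Longrightarrow> (a', b', c', d', S', T', L') \<in> set fs \<Longrightarrow>
      0 \<le> i \<Longrightarrow> i < L \<Longrightarrow> 0 \<le> j \<Longrightarrow> j < L' \<Longrightarrow> \<bar>T + 2 * i\<bar> = \<bar>T' + 2 * j\<bar> \<Longrightarrow> a + i = a' + j \<and> b + i = b' + j \<and> c + i = c' + j \<and> d - 3 * i = d' - 3 * j"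
    and diagonal_12: "(a, b, c, d, S, T, L) \<in> set fs \<Longrightarrow> (a', b', c', d', S', T', L') \<in> set fs \<Longrightarrow>
      0 \<le> i \<Longrightarrow> i < L \<Longrightarrow> 0 \<le> j \<Longrightarrow> j < L' \<Longrightarrow> \<bar>S + 2 * i\<bar> \<noteq> \<bar>T' + 2 * j\<bar>"
begin

abbreviation Q :: "(int \<times> int \<times> int \<times> int) set" where
  "Q \<equiv> (\<Union>f\<in>set fs. members f)"

interpretation cyclic_base n Q .

lemma memberE:
  assumes "(p, q, r, s) \<in> Q"
  obtains a b c d S T L i where "(a, b, c, d, S, T, L) \<in> set fs" "0 \<le> i" "i < L"
    "p = a + i" "q = b + i" "r = c + i" "s = d - 3 * i" "center (p + q) = S + 2 * i" "center (q + r) = T + 2 * i"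
proof -
  obtain f where f: "f \<in> set fs" "(p, q, r, s) \<in> members f"
    using assms by blast
  obtain a b c d S T L where abc: "f = (a, b, c, d, S, T, L)"
    by (cases f) auto
  obtain i where i: "0 \<le> i" "i < L" "p = a + i" "q = b + i" "r = c + i" "s = d - 3 * i"
    using f(2) unfolding abc by auto
  note in_fs = f(1)[unfolded abc]
  have center: "center w = W" if W: "W - w \<in> {0, v, - v}" "\<bar>W\<bar> \<le> 4 * int n" for w W
  proof -
    consider "W = w - v * 0" | "W = w - v * (- 1)" | "W = w - v * 1"
      using W(1) by fastforce
    then show ?thesis
      using center_eq[of w] W(2) by cases metis+
  qed
  have pq: "p + q = a + b + 2 * i" "q + r = b + c + 2 * i"
    using i by simp_all
  have "center (p + q) = S + 2 * i" "center (q + r) = T + 2 * i"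
    unfolding pq using diagonals[OF in_fs] range[OF in_fs i(1,2), of "S + 2 * i"] range[OF in_fs i(1,2), of "T + 2 * i"]
    by (simp_all add: center)
  then show ?thesis
    using that[OF in_fs i] by blast
qed

sublocale cyclic_sparse_base n Q
proof
  show "finite Q"
    by (auto simp: members.simps)
  have "card (members f) \<le> nat (family_size f)" for f
  proof (cases f)
    case (fields a b c d S T L)
    then show ?thesis
      using card_image_le[of "{0..<L}" "\<lambda>i. (a + i, b + i, c + i, d - 3 * i)"] by simp
  qed
  then have "(\<Sum>f\<leftarrow>fs. card (members f)) \<le> n"
    using size_sum by (meson order_trans sum_list_mono)
  moreover have "card (\<Union>f\<in>set gs. members f) \<le> (\<Sum>f\<leftarrow>gs. card (members f))" for gs
  proof (induction gs)
    case (Cons f gs)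
    then show ?case
      using card_Un_le[of "members f" "\<Union>f\<in>set gs. members f"] by simp
  qed simp
  ultimately show "card Q \<le> n"
    using order_trans by blast
next
  fix p q r s w assume Q: "(p, q, r, s) \<in> Q"
  obtain a b c d S T L i where 0: "(a, b, c, d, S, T, L) \<in> set fs" "0 \<le> i" "i < L"
    "p = a + i" "q = b + i" "r = c + i" "s = d - 3 * i" "center (p + q) = S + 2 * i" "center (q + r) = T + 2 * i"
    using Q by (rule memberE)
  show "p + q + r + s = 0"
    using sum_zero[OF 0(1)] 0(4-7) by simp
  show "\<bar>w\<bar> \<le> 4 * int n" if "w \<in> {p, q, r, s}"
    using that range[OF 0(1-3), of w] unfolding 0(4-7) by blast
  show "w \<noteq> 0" if "w \<in> {p, q, r, s, center (p + q), center (q + r)}"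
    using that range[OF 0(1-3), of w] unfolding 0(8,9) unfolding 0(4-7) by blast
next
  fix z :: int assume "1 \<le> z" "z \<le> 4 * int n"
  then obtain f i where f: "f \<in> set fs" "covers f i z"
    using covered by blast
  obtain a b c d S T L where abc: "f = (a, b, c, d, S, T, L)"
    by (cases f) auto
  have i: "0 \<le> i" "i < L" and z: "z \<in> {\<bar>a + i\<bar>, \<bar>b + i\<bar>, \<bar>c + i\<bar>, \<bar>d - 3 * i\<bar>}"
    using f(2) unfolding abc by simp_all
  have "(a + i, b + i, c + i, d - 3 * i) \<in> Q"
    using i by (intro UN_I[OF f(1)]) (simp add: abc)
  moreover have "z \<in> {a + i, b + i, c + i, d - 3 * i} \<or> - z \<in> {a + i, b + i, c + i, d - 3 * i}"
    using z by (auto simp: abs_if)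
  ultimately show "\<exists>(a, b, c, d)\<in>Q. z \<in> {a, b, c, d} \<or> - z \<in> {a, b, c, d}"
    by (intro bexI[of _ "(a + i, b + i, c + i, d - 3 * i)"]) simp_all
next
  fix p q r s p' q' r' s' assume Q: "(p, q, r, s) \<in> Q" "(p', q', r', s') \<in> Q"
  obtain a b c d S T L i where 1: "(a, b, c, d, S, T, L) \<in> set fs" "0 \<le> i" "i < L"
    "p = a + i" "q = b + i" "r = c + i" "s = d - 3 * i" "center (p + q) = S + 2 * i" "center (q + r) = T + 2 * i"
    using Q(1) by (rule memberE)
  obtain a' b' c' d' S' T' L' j where 2: "(a', b', c', d', S', T', L') \<in> set fs" "0 \<le> j" "j < L'"
    "p' = a' + j" "q' = b' + j" "r' = c' + j" "s' = d' - 3 * j" "center (p' + q') = S' + 2 * j"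
    "center (q' + r') = T' + 2 * j"
    using Q(2) by (rule memberE)
  show "\<bar>center (p + q)\<bar> = \<bar>center (p' + q')\<bar> \<Longrightarrow> (p, q, r, s) = (p', q', r', s')"
    using diagonal_1[OF 1(1) 2(1) 1(2,3) 2(2,3)] unfolding 1(8) 2(8) unfolding 1(4-7) 2(4-7) by simp
  show "\<bar>center (q + r)\<bar> = \<bar>center (q' + r')\<bar> \<Longrightarrow> (p, q, r, s) = (p', q', r', s')"
    using diagonal_2[OF 1(1) 2(1) 1(2,3) 2(2,3)] unfolding 1(9) 2(9) unfolding 1(4-7) 2(4-7) by simp
  show "\<bar>center (p + q)\<bar> \<noteq> \<bar>center (q' + r')\<bar>"
    using diagonal_12[OF 1(1) 2(1) 1(2,3) 2(2,3)] unfolding 1(8) 2(9) .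
qed

lemma turns_arcs:
  assumes "(t, u) \<in> turns"
  shows "\<exists>k. arcs fs 0 k t u"
proof -
  obtain p q r s where Q: "(p, q, r, s) \<in> Q" and
    tu: "(t, u) \<in> {(p, center (p + q)), (- s, center (p + q)), (q, center (q + r)), (- p, center (q + r)),
       (r, - center (p + q)), (- q, - center (p + q)), (s, - center (q + r)), (- r, - center (q + r))}"
    using assms unfolding turns_def mem_Collect_eq case_prod_conv by blast
  obtain a b c d S T L i where *: "(a, b, c, d, S, T, L) \<in> set fs" and i: "0 \<le> i" "i < L"
    "p = a + i" "q = b + i" "r = c + i" "s = d - 3 * i" "center (p + q) = S + 2 * i" "center (q + r) = T + 2 * i"
    using Q by (rule memberE)
  have arc: "\<exists>k. arc (a, b, c, d, S, T, L) n k t u" for n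
    using tu i(1,2) unfolding i(7,8) unfolding i(3-6) arc.simps
    by (elim insertE emptyE Pair_inject) (simp_all add: ex_disj_distrib)
  have "\<exists>k. arcs gs n k t u" if "(a, b, c, d, S, T, L) \<in> set gs" for gs n
    using that
  proof (induction gs arbitrary: n)
    case (Cons g gs)
    show ?case
    proof (cases "(a, b, c, d, S, T, L) = g")
      case True
      then show ?thesis
        unfolding arcs.simps using arc by blast
    next
      case False
      then show ?thesis
        unfolding arcs.simps using Cons by auto
    qed
  qed simp
  then show ?thesis using * by blast
qed

lemma strictly_sparse_system_if:
  assumes "\<And>t u w u' w' k l p k' l' p'. arcs fs 0 k t u \<Longrightarrow> arcs fs 0 l u w \<Longrightarrow> arcs fs 0 p w t \<Longrightarrow>
    arcs fs 0 k' (- t) u' \<Longrightarrow> arcs fs 0 l' u' w' \<Longrightarrow> arcs fs 0 p' w' (- t) \<Longrightarrow> False"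
  shows "strictly_sparse 4 system"
  using strictly_sparse_system assms turns_arcs by metis

end

lemma coversI: "k < length fs \<Longrightarrow> covers (fs ! k) i z \<Longrightarrow> \<exists>f\<in>set fs. \<exists>i. covers f i z"
  using nth_mem by blast

text \<open>
  The map of differences has eight linear pieces per family. An entry \<open>E ! k\<close> lists the pieces
  that can follow piece \<open>k\<close>, so orbits of period three pass through triangles of this graph.
\<close>

definition closed_in :: "nat list list \<Rightarrow> (nat \<times> nat \<times> nat) list \<Rightarrow> bool" where
  "closed_in E Ts \<longleftrightarrow> (\<forall>a\<in>set [0..<length E]. \<forall>b\<in>set (E ! a). \<forall>c\<in>set (E ! b). a \<in> set (E ! c) \<longrightarrow> (a, b, c) \<in> set Ts)"

lemma closed_inD: "closed_in E Ts \<Longrightarrow> a < length E \<Longrightarrow> b \<in> set (E ! a) \<Longrightarrow> c \<in> set (E ! b) \<Longrightarrow> a \<in> set (E ! c) \<Longrightarrow>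
  (a, b, c) \<in> set Ts"
  unfolding closed_in_def by auto

text \<open>The three lists of families, one for each residue of \<open>n\<close> modulo 3, come from a computer search.\<close>

definition families_1 :: "int \<Rightarrow> family list" where
  "families_1 m =
    [(4 * m + 2, 6 * m + 3, - 9 * m - 3, - m - 2, 10 * m + 5, - 3 * m, m),
     (2, - 10 * m - 3, 11 * m + 4, - m - 3, - 10 * m - 1, m + 1, m),
     (7 * m + 4, 5 * m + 3, - 11 * m - 3, - m - 4, - 12 * m - 2, - 6 * m, m),
     (12 * m + 4, - 5 * m - 2, - 7 * m - 3, 1, 7 * m + 2, 12 * m + 4, 1)]"

definition successors_1 :: "nat list list" where
  "successors_1 =
    [[12, 23], [12, 23], [6, 14, 22], [6, 14, 22], [15, 20], [15, 20], [1, 9, 17], [1, 9, 17], [4,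
     10, 19], [4, 10, 19], [1, 8, 9, 17], [1, 8, 9, 17], [7, 13, 16], [7, 13, 16], [6, 11, 14, 22],
     [6, 11, 14, 22], [15, 20], [15, 20], [3, 21, 26], [3, 21, 26], [12, 23], [12, 23], [0, 18, 29],
     [0, 18, 29], [2], [2], [24], [24], [5], [5], [27], [27]]"

definition triangles_1 :: "(nat \<times> nat \<times> nat) list" where
  "triangles_1 =
    [(1, 12, 7), (3, 22, 18), (6, 17, 15), (7, 1, 12), (11, 17, 15), (12, 7, 1), (12, 16, 20), (13,
     13, 13), (14, 14, 14), (15, 6, 17), (15, 11, 17), (16, 20, 12), (17, 15, 6), (17, 15, 11), (18,
     3, 22), (18, 21, 23), (20, 12, 16), (21, 23, 18), (22, 18, 3), (23, 18, 21)]"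

lemma closed_in_1: "closed_in successors_1 triangles_1"
  by code_simp

text \<open>Evaluating \<open>arcs\<close> once on the concrete list leaves one alternative of
  linear constraints per piece.\<close>

lemmas arcs_families_1D =
  iffD1[OF arg_cong[of "families_1 m" _ "\<lambda>fs. arcs fs 0 k t u" for m k t u, OF families_1_def, simplified]]

text \<open>For pairs of pieces that are not listed, the range of the first misses the domain of the
  second for every \<open>m\<close>.\<close>

lemma successor_1:
  assumes "m \<ge> 1" "arcs (families_1 m) 0 k t u" "arcs (families_1 m) 0 l u w"
  shows "l \<in> set (successors_1 ! k) \<and> k < length successors_1"
  using assms
  by - ((drule arcs_families_1D; elim disjE exE conjE; hypsubst_thin); (drule arcs_families_1D; elim disjE exE conjE; hypsubst_thin);
    (linarith | simp add: successors_1_def))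

definition families_2 :: "int \<Rightarrow> family list" where
  "families_2 m =
    [(7 * m + 5, 5 * m + 4, - 11 * m - 7, - m - 2, - 12 * m - 8, - 6 * m - 3, m + 1),
     (4 * m + 4, 6 * m + 5, - 9 * m - 6, - m - 3, 10 * m + 9, - 3 * m - 1, m),
     (2, - 10 * m - 6, 11 * m + 8, - m - 4, - 10 * m - 4, m + 2, m),
     (- 8 * m - 6, 12 * m + 8, - 4 * m - 3, 1, 4 * m + 2, 8 * m + 5, 1)]"

definition successors_2 :: "nat list list" where
  "successors_2 =
    [[4, 23, 29], [4, 23, 29], [5, 11, 28], [5, 11, 28], [7, 20, 26], [7, 20, 26], [2, 8, 31], [2,
     8, 31], [7, 20], [7, 20], [6, 14, 22], [6, 14, 22], [4, 23], [4, 23], [1, 9, 17], [1, 9, 17],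
     [12, 18, 24], [12, 18, 24], [1, 9, 17], [1, 9, 17], [15, 21, 27], [15, 21, 27], [6, 14, 22],
     [6, 14, 22], [1], [1], [0], [0], [6], [6], [3], [3]]"

definition triangles_2 :: "(nat \<times> nat \<times> nat) list" where
  "triangles_2 =
    [(0, 4, 26), (1, 23, 14), (2, 5, 7), (2, 11, 6), (2, 28, 6), (4, 26, 0), (5, 7, 2), (6, 2, 11),
     (6, 2, 28), (7, 2, 5), (9, 20, 15), (11, 6, 2), (14, 1, 23), (15, 9, 20), (20, 15, 9), (21, 21,
     21), (22, 22, 22), (23, 14, 1), (26, 0, 4), (28, 6, 2)]"

lemma closed_in_2: "closed_in successors_2 triangles_2"
  by code_simp

lemmas arcs_families_2D =
  iffD1[OF arg_cong[of "families_2 m" _ "\<lambda>fs. arcs fs 0 k t u" for m k t u, OF families_2_def, simplified]]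

lemma successor_2:
  assumes "m \<ge> 0" "arcs (families_2 m) 0 k t u" "arcs (families_2 m) 0 l u w"
  shows "l \<in> set (successors_2 ! k) \<and> k < length successors_2"
  using assms
  by - ((drule arcs_families_2D; elim disjE exE conjE; hypsubst_thin); (drule arcs_families_2D; elim disjE exE conjE; hypsubst_thin);
    (linarith | simp add: successors_2_def))

definition families_3 :: "int \<Rightarrow> family list" where
  "families_3 m =
    [(5 * m + 6, 9 * m + 10, - 12 * m - 12, - 2 * m - 4, - 10 * m - 9, - 3 * m - 2, m + 1),
     (- 8 * m - 7, 1, 10 * m + 11, - 2 * m - 5, - 8 * m - 6, 10 * m + 12, m + 1),
     (m + 3, - 7 * m - 6, 8 * m + 9, - 2 * m - 6, - 6 * m - 3, m + 3, m),
     (9 * m + 9, - 8 * m - 8, - 2 * m - 3, m + 2, m + 1, - 10 * m - 11, 1)]"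

definition successors_3 :: "nat list list" where
  "successors_3 =
    [[5, 23, 27], [5, 23, 27], [6, 14, 19, 22, 25, 28], [6, 14, 19, 22, 25, 28], [2, 20, 24], [2,
     20, 24], [1, 9, 16, 17, 30, 31], [1, 9, 16, 17, 30, 31], [3, 8, 18], [3, 8, 18], [7, 12], [7,
     12], [0, 11, 21], [0, 11, 21], [4, 15], [4, 15], [3, 6, 14, 22], [3, 6, 14, 22], [1, 9, 16, 17,
     31], [1, 9, 16, 17, 31], [0, 1, 9, 17], [0, 1, 9, 17], [6, 14, 19, 22, 28], [6, 14, 19, 22,
     28], [10], [10], [15], [15], [13], [13], [12], [12]]"

definition triangles_3 :: "(nat \<times> nat \<times> nat) list" where
  "triangles_3 =
    [(0, 5, 20), (1, 5, 20), (1, 23, 6), (1, 23, 19), (2, 14, 4), (3, 6, 9), (3, 6, 16), (3, 6, 17),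
     (3, 19, 9), (3, 19, 16), (3, 19, 17), (4, 2, 14), (5, 20, 0), (5, 20, 1), (6, 1, 23), (6, 9,
     3), (6, 16, 3), (6, 16, 22), (6, 17, 3), (6, 17, 22), (8, 8, 8), (8, 18, 9), (9, 3, 6), (9, 3,
     19), (9, 8, 18), (14, 4, 2), (15, 15, 15), (16, 3, 6), (16, 3, 19), (16, 22, 6), (16, 22, 19),
     (17, 3, 6), (17, 3, 19), (17, 22, 6), (17, 22, 19), (18, 9, 8), (19, 1, 23), (19, 9, 3), (19,
     16, 3), (19, 16, 22), (19, 17, 3), (19, 17, 22), (20, 0, 5), (20, 1, 5), (22, 6, 16), (22, 6,
     17), (22, 19, 16), (22, 19, 17), (22, 22, 22), (23, 6, 1), (23, 19, 1)]"

lemma closed_in_3: "closed_in successors_3 triangles_3"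
  by code_simp

lemmas arcs_families_3D =
  iffD1[OF arg_cong[of "families_3 m" _ "\<lambda>fs. arcs fs 0 k t u" for m k t u, OF families_3_def, simplified]]

lemma successor_3:
  assumes "m \<ge> 0" "arcs (families_3 m) 0 k t u" "arcs (families_3 m) 0 l u w"
  shows "l \<in> set (successors_3 ! k) \<and> k < length successors_3"
  using assms
  by - ((drule arcs_families_3D; elim disjE exE conjE; hypsubst_thin); (drule arcs_families_3D; elim disjE exE conjE; hypsubst_thin);
    (linarith | simp add: successors_3_def))

section \<open>Differences, diagonals and periodic orbits for \<open>n = 3 * m + 1\<close>\<close>

lemma triangle_1:
  assumes "m \<ge> 1" "arcs (families_1 m) 0 k t u" "arcs (families_1 m) 0 l u w" "arcs (families_1 m) 0 p w t"
  shows "(k, l, p) \<in> set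
    [(1, 12, 7), (3, 22, 18), (7, 1, 12), (11, 17, 15), (12, 7, 1), (15, 11, 17), (17, 15, 11), (18,
     3, 22), (18, 21, 23), (21, 23, 18), (22, 18, 3), (23, 18, 21)]"
proof -
  have "(k, l, p) \<in> set triangles_1"
    using closed_inD[OF closed_in_1] successor_1[OF assms(1-3)] successor_1[OF assms(1,3,4)]
      successor_1[OF assms(1,4,2)] by blast
  \<comment> \<open>The three equations have a single rational solution in terms of
    \<open>m\<close>. In the triangles dropped here it violates a bound; \<open>(1, 12, 7)\<close>
    stays because it occurs for \<open>m = 4\<close>.\<close>
  then show ?thesis
    using assms(1) assms(2-4)[THEN arcs_families_1D] unfolding triangles_1_def list.set
    by - (elim insertE emptyE Pair_inject; hypsubst_thin; simp (no_asm_use); elim conjE; linarith)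
qed

text \<open>Each remaining triangle fixes \<open>t\<close> as an affine function of
  \<open>m\<close>. For any choice of one triangle for \<open>t\<close> and one for
  \<open>- t\<close>, these values or their ranges are incompatible.\<close>

lemma no_two_triangles_1:
  assumes "m \<ge> 1" "arcs (families_1 m) 0 k t u" "arcs (families_1 m) 0 l u w" "arcs (families_1 m) 0 p w t"
    "arcs (families_1 m) 0 k' (- t) u'" "arcs (families_1 m) 0 l' u' w'" "arcs (families_1 m) 0 p' w' (- t)"
  shows False
  using triangle_1[OF assms(1-4)] triangle_1[OF assms(1,5-7)] assms(1) assms(2-7)[THEN arcs_families_1D]
  unfolding list.set
  by - (elim insertE emptyE Pair_inject; hypsubst_thin; simp (no_asm_use); elim conjE; linarith)

lemma covered_1:
  assumes "m \<ge> 1" "1 \<le> z" "z \<le> 12 * m + 4"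
  shows "\<exists>f\<in>set (families_1 m). \<exists>i. covers f i z"
proof -
  have abs: "\<bar>z\<bar> = z" using assms(2) by simp
  have start: "\<not> z \<le> 0" using assms(2) by simp
  have 0: ?thesis if "\<not> z \<le> 0" "z \<le> 1"
    by (rule coversI[of 3 _ "0"]) (use that abs assms(1) in \<open>simp_all add: families_1_def\<close>)
  have 1: ?thesis if "\<not> z \<le> 1" "z \<le> m + 1"
    by (rule coversI[of 1 _ "z - (2)"]) (use that abs assms(1) in \<open>simp_all add: families_1_def\<close>)
  \<comment> \<open>The entries of step 3 of the three families, one residue class each.\<close>
  have 2: ?thesis if that: "\<not> z \<le> m + 1" "z \<le> 4 * m + 1"
  proof -
    have "\<exists>i. z = m + 2 + 3 * i \<or> z = m + 3 + 3 * i \<or> z = m + 4 + 3 * i" by presburger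
    then obtain i where "z = m + 2 + 3 * i \<or> z = m + 3 + 3 * i \<or> z = m + 4 + 3 * i" ..
    then show ?thesis
      by (elim disjE) ((rule coversI[of 0 _ i], simp add: families_1_def, use that assms(1) in \<open>simp add: families_1_def abs_if\<close>), (rule coversI[of 1 _ i], simp add: families_1_def, use that assms(1) in \<open>simp add: families_1_def abs_if\<close>), (rule coversI[of 2 _ i], simp add: families_1_def, use that assms(1) in \<open>simp add: families_1_def abs_if\<close>))
  qed
  have 3: ?thesis if "\<not> z \<le> 4 * m + 1" "z \<le> 5 * m + 1"
    by (rule coversI[of 0 _ "z - (4 * m + 2)"]) (use that abs assms(1) in \<open>simp_all add: families_1_def\<close>)
  have 4: ?thesis if "\<not> z \<le> 5 * m + 1" "z \<le> 5 * m + 2"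
    by (rule coversI[of 3 _ "- z - (- 5 * m - 2)"]) (use that abs assms(1) in \<open>simp_all add: families_1_def\<close>)
  have 5: ?thesis if "\<not> z \<le> 5 * m + 2" "z \<le> 6 * m + 2"
    by (rule coversI[of 2 _ "z - (5 * m + 3)"]) (use that abs assms(1) in \<open>simp_all add: families_1_def\<close>)
  have 6: ?thesis if "\<not> z \<le> 6 * m + 2" "z \<le> 7 * m + 2"
    by (rule coversI[of 0 _ "z - (6 * m + 3)"]) (use that abs assms(1) in \<open>simp_all add: families_1_def\<close>)
  have 7: ?thesis if "\<not> z \<le> 7 * m + 2" "z \<le> 7 * m + 3"
    by (rule coversI[of 3 _ "- z - (- 7 * m - 3)"]) (use that abs assms(1) in \<open>simp_all add: families_1_def\<close>)
  have 8: ?thesis if "\<not> z \<le> 7 * m + 3" "z \<le> 8 * m + 3"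
    by (rule coversI[of 2 _ "z - (7 * m + 4)"]) (use that abs assms(1) in \<open>simp_all add: families_1_def\<close>)
  have 9: ?thesis if "\<not> z \<le> 8 * m + 3" "z \<le> 9 * m + 3"
    by (rule coversI[of 0 _ "- z - (- 9 * m - 3)"]) (use that abs assms(1) in \<open>simp_all add: families_1_def\<close>)
  have 10: ?thesis if "\<not> z \<le> 9 * m + 3" "z \<le> 10 * m + 3"
    by (rule coversI[of 1 _ "- z - (- 10 * m - 3)"]) (use that abs assms(1) in \<open>simp_all add: families_1_def\<close>)
  have 11: ?thesis if "\<not> z \<le> 10 * m + 3" "z \<le> 11 * m + 3"
    by (rule coversI[of 2 _ "- z - (- 11 * m - 3)"]) (use that abs assms(1) in \<open>simp_all add: families_1_def\<close>)
  have 12: ?thesis if "\<not> z \<le> 11 * m + 3" "z \<le> 12 * m + 3"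
    by (rule coversI[of 1 _ "z - (11 * m + 4)"]) (use that abs assms(1) in \<open>simp_all add: families_1_def\<close>)
  have 13: ?thesis if "\<not> z \<le> 12 * m + 3" "z \<le> 12 * m + 4"
    by (rule coversI[of 3 _ "z - (12 * m + 4)"]) (use that abs assms(1) in \<open>simp_all add: families_1_def\<close>)
  show ?thesis
    using start assms(3) 0 1 2 3 4 5 6 7 8 9 10 11 12 13 by satx
qed

lemma range_1:
  assumes "m \<ge> 1" "(a, b, c, d, S, T, L) \<in> set (families_1 m)" "0 \<le> i" "i < L"
    "w \<in> {a + i, b + i, c + i, d - 3 * i, S + 2 * i, T + 2 * i}"
  shows "w \<noteq> 0 \<and> \<bar>w\<bar> \<le> 12 * m + 4"
  using assms unfolding families_1_def list.set abs_le_iff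
  by - (elim insertE emptyE Pair_inject; hypsubst_thin; intro conjI notI; linarith)

text \<open>Each family has diagonal differences of constant parity. The overlapping ranges, 10m + 5
  to 12m + 3 and 10m + 4 to 12m + 2 in absolute value, have opposite parities; hence the use of
  \<open>even\<close>.\<close>

lemma diagonal_1_1:
  assumes "m \<ge> 1" "(a, b, c, d, S, T, L) \<in> set (families_1 m)" "0 \<le> i" "i < L"
    "(a', b', c', d', S', T', L') \<in> set (families_1 m)" "0 \<le> j" "j < L'"
    "\<bar>S + 2 * i\<bar> = \<bar>S' + 2 * j\<bar>"
  shows "a + i = a' + j \<and> b + i = b' + j \<and> c + i = c' + j \<and> d - 3 * i = d' - 3 * j"
  using assms unfolding families_1_def list.set abs_eq_iff
  by - (elim insertE emptyE Pair_inject disjE; hypsubst_thin; (intro conjI)?; (linarith | (drule arg_cong[where f = "even :: int \<Rightarrow> bool"], simp; fail) | presburger))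

text \<open>Parity separates the ranges m + 2 to 3m and m + 1 to 3m - 1 of the first two
  families.\<close>

lemma diagonal_2_1:
  assumes "m \<ge> 1" "(a, b, c, d, S, T, L) \<in> set (families_1 m)" "0 \<le> i" "i < L"
    "(a', b', c', d', S', T', L') \<in> set (families_1 m)" "0 \<le> j" "j < L'"
    "\<bar>T + 2 * i\<bar> = \<bar>T' + 2 * j\<bar>"
  shows "a + i = a' + j \<and> b + i = b' + j \<and> c + i = c' + j \<and> d - 3 * i = d' - 3 * j"
  using assms unfolding families_1_def list.set abs_eq_iff
  by - (elim insertE emptyE Pair_inject disjE; hypsubst_thin; (intro conjI)?; (linarith | (drule arg_cong[where f = "even :: int \<Rightarrow> bool"], simp; fail) | presburger))

lemma diagonal_12_1:
  assumes "m \<ge> 1" "(a, b, c, d, S, T, L) \<in> set (families_1 m)" "0 \<le> i" "i < L"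
    "(a', b', c', d', S', T', L') \<in> set (families_1 m)" "0 \<le> j" "j < L'"
    "\<bar>S + 2 * i\<bar> = \<bar>T' + 2 * j\<bar>"
  shows False
  using assms unfolding families_1_def list.set abs_eq_iff
  by - (elim insertE emptyE Pair_inject disjE; hypsubst_thin; (intro conjI)?; (linarith | (drule arg_cong[where f = "even :: int \<Rightarrow> bool"], simp; fail) | presburger))

lemma base_families_1:
  fixes m :: nat
  assumes "m \<ge> 1"
  shows "base_families (3 * m + 1) (families_1 (int m))"
proof
  have m: "int m \<ge> 1" using assms by simp
  have N: "4 * int (3 * m + 1) = 12 * int m + 4" by simp
  show "(\<Sum>f\<leftarrow>families_1 (int m). nat (family_size f)) \<le> 3 * m + 1"
    by (simp add: families_1_def nat_add_distrib)
  show "\<exists>f\<in>set (families_1 (int m)). \<exists>i. covers f i z" if "1 \<le> z" "z \<le> 4 * int (3 * m + 1)" for z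
    using covered_1[OF m that(1)] that(2) unfolding N by blast
  fix a b c d S T L assume 1: "(a, b, c, d, S, T, L) \<in> set (families_1 (int m))"
  show "a + b + c + d = 0"
    using 1 by (auto simp: families_1_def)
  show "S - (a + b) \<in> {0, 8 * int (3 * m + 1) + 1, - (8 * int (3 * m + 1) + 1)} \<and>
    T - (b + c) \<in> {0, 8 * int (3 * m + 1) + 1, - (8 * int (3 * m + 1) + 1)}"
    using 1 by (auto simp: families_1_def)
  fix i :: int assume i: "0 \<le> i" "i < L"
  show "w \<noteq> 0 \<and> \<bar>w\<bar> \<le> 4 * int (3 * m + 1)"
    if "w \<in> {a + i, b + i, c + i, d - 3 * i, S + 2 * i, T + 2 * i}" for w
    unfolding N using range_1[OF m 1 i that] by blast
  fix a' b' c' d' S' T' L' j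
  assume 2: "(a', b', c', d', S', T', L') \<in> set (families_1 (int m))" and j: "0 \<le> j" "j < L'"
  show "a + i = a' + j \<and> b + i = b' + j \<and> c + i = c' + j \<and> d - 3 * i = d' - 3 * j"
    if "\<bar>S + 2 * i\<bar> = \<bar>S' + 2 * j\<bar>"
    using diagonal_1_1[OF m 1 i 2 j that] .
  show "a + i = a' + j \<and> b + i = b' + j \<and> c + i = c' + j \<and> d - 3 * i = d' - 3 * j"
    if "\<bar>T + 2 * i\<bar> = \<bar>T' + 2 * j\<bar>"
    using diagonal_2_1[OF m 1 i 2 j that] .
  show "\<bar>S + 2 * i\<bar> \<noteq> \<bar>T' + 2 * j\<bar>"
    using diagonal_12_1[OF m 1 i 2 j] by blast
qed

section \<open>Differences, diagonals and periodic orbits for \<open>n = 3 * m + 2\<close>\<close>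

lemma triangle_2:
  assumes "m \<ge> 0" "arcs (families_2 m) 0 k t u" "arcs (families_2 m) 0 l u w" "arcs (families_2 m) 0 p w t"
  shows "(k, l, p) \<in> set
    [(0, 4, 26), (2, 5, 7), (2, 11, 6), (4, 26, 0), (5, 7, 2), (6, 2, 11), (7, 2, 5), (9, 20, 15),
     (11, 6, 2), (15, 9, 20), (20, 15, 9), (26, 0, 4)]"
proof -
  have "(k, l, p) \<in> set triangles_2"
    using closed_inD[OF closed_in_2] successor_2[OF assms(1-3)] successor_2[OF assms(1,3,4)]
      successor_2[OF assms(1,4,2)] by blast
  then show ?thesis
    using assms(1) assms(2-4)[THEN arcs_families_2D] unfolding triangles_2_def list.set
    by - (elim insertE emptyE Pair_inject; hypsubst_thin; simp (no_asm_use); elim conjE; linarith)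
qed

lemma no_two_triangles_2:
  assumes "m \<ge> 0" "arcs (families_2 m) 0 k t u" "arcs (families_2 m) 0 l u w" "arcs (families_2 m) 0 p w t"
    "arcs (families_2 m) 0 k' (- t) u'" "arcs (families_2 m) 0 l' u' w'" "arcs (families_2 m) 0 p' w' (- t)"
  shows False
  using triangle_2[OF assms(1-4)] triangle_2[OF assms(1,5-7)] assms(1) assms(2-7)[THEN arcs_families_2D]
  unfolding list.set
  by - (elim insertE emptyE Pair_inject; hypsubst_thin; simp (no_asm_use); elim conjE; linarith)

lemma covered_2:
  assumes "m \<ge> 0" "1 \<le> z" "z \<le> 12 * m + 8"
  shows "\<exists>f\<in>set (families_2 m). \<exists>i. covers f i z"
proof -
  have abs: "\<bar>z\<bar> = z" using assms(2) by simp
  have start: "\<not> z \<le> 0" using assms(2) by simp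
  have 0: ?thesis if "\<not> z \<le> 0" "z \<le> 1"
    by (rule coversI[of 3 _ "0"]) (use that abs assms(1) in \<open>simp_all add: families_2_def\<close>)
  have 1: ?thesis if "\<not> z \<le> 1" "z \<le> m + 1"
    by (rule coversI[of 2 _ "z - (2)"]) (use that abs assms(1) in \<open>simp_all add: families_2_def\<close>)
  \<comment> \<open>The first family is longer by one, so its progression supplies both ends of the
    interval.\<close>
  have 2: ?thesis if that: "\<not> z \<le> m + 1" "z \<le> 4 * m + 2"
  proof -
    have "\<exists>i. z = m + 2 + 3 * i \<or> z = m + 3 + 3 * i \<or> z = m + 4 + 3 * i" by presburger
    then obtain i where "z = m + 2 + 3 * i \<or> z = m + 3 + 3 * i \<or> z = m + 4 + 3 * i" ..
    then show ?thesis
      by (elim disjE) ((rule coversI[of 0 _ i], simp add: families_2_def, use that assms(1) in \<open>simp add: families_2_def abs_if\<close>), (rule coversI[of 1 _ i], simp add: families_2_def, use that assms(1) in \<open>simp add: families_2_def abs_if\<close>), (rule coversI[of 2 _ i], simp add: families_2_def, use that assms(1) in \<open>simp add: families_2_def abs_if\<close>))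
  qed
  have 3: ?thesis if "\<not> z \<le> 4 * m + 2" "z \<le> 4 * m + 3"
    by (rule coversI[of 3 _ "- z - (- 4 * m - 3)"]) (use that abs assms(1) in \<open>simp_all add: families_2_def\<close>)
  have 4: ?thesis if "\<not> z \<le> 4 * m + 3" "z \<le> 5 * m + 3"
    by (rule coversI[of 1 _ "z - (4 * m + 4)"]) (use that abs assms(1) in \<open>simp_all add: families_2_def\<close>)
  have 5: ?thesis if "\<not> z \<le> 5 * m + 3" "z \<le> 6 * m + 4"
    by (rule coversI[of 0 _ "z - (5 * m + 4)"]) (use that abs assms(1) in \<open>simp_all add: families_2_def\<close>)
  have 6: ?thesis if "\<not> z \<le> 6 * m + 4" "z \<le> 7 * m + 4"
    by (rule coversI[of 1 _ "z - (6 * m + 5)"]) (use that abs assms(1) in \<open>simp_all add: families_2_def\<close>)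
  have 7: ?thesis if "\<not> z \<le> 7 * m + 4" "z \<le> 8 * m + 5"
    by (rule coversI[of 0 _ "z - (7 * m + 5)"]) (use that abs assms(1) in \<open>simp_all add: families_2_def\<close>)
  have 8: ?thesis if "\<not> z \<le> 8 * m + 5" "z \<le> 8 * m + 6"
    by (rule coversI[of 3 _ "- z - (- 8 * m - 6)"]) (use that abs assms(1) in \<open>simp_all add: families_2_def\<close>)
  have 9: ?thesis if "\<not> z \<le> 8 * m + 6" "z \<le> 9 * m + 6"
    by (rule coversI[of 1 _ "- z - (- 9 * m - 6)"]) (use that abs assms(1) in \<open>simp_all add: families_2_def\<close>)
  have 10: ?thesis if "\<not> z \<le> 9 * m + 6" "z \<le> 10 * m + 6"
    by (rule coversI[of 2 _ "- z - (- 10 * m - 6)"]) (use that abs assms(1) in \<open>simp_all add: families_2_def\<close>)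
  have 11: ?thesis if "\<not> z \<le> 10 * m + 6" "z \<le> 11 * m + 7"
    by (rule coversI[of 0 _ "- z - (- 11 * m - 7)"]) (use that abs assms(1) in \<open>simp_all add: families_2_def\<close>)
  have 12: ?thesis if "\<not> z \<le> 11 * m + 7" "z \<le> 12 * m + 7"
    by (rule coversI[of 2 _ "z - (11 * m + 8)"]) (use that abs assms(1) in \<open>simp_all add: families_2_def\<close>)
  have 13: ?thesis if "\<not> z \<le> 12 * m + 7" "z \<le> 12 * m + 8"
    by (rule coversI[of 3 _ "z - (12 * m + 8)"]) (use that abs assms(1) in \<open>simp_all add: families_2_def\<close>)
  show ?thesis
    using start assms(3) 0 1 2 3 4 5 6 7 8 9 10 11 12 13 by satx
qed

lemma range_2:
  assumes "m \<ge> 0" "(a, b, c, d, S, T, L) \<in> set (families_2 m)" "0 \<le> i" "i < L"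
    "w \<in> {a + i, b + i, c + i, d - 3 * i, S + 2 * i, T + 2 * i}"
  shows "w \<noteq> 0 \<and> \<bar>w\<bar> \<le> 12 * m + 8"
  using assms unfolding families_2_def list.set abs_le_iff
  by - (elim insertE emptyE Pair_inject; hypsubst_thin; intro conjI notI; linarith)

lemma diagonal_1_2:
  assumes "m \<ge> 0" "(a, b, c, d, S, T, L) \<in> set (families_2 m)" "0 \<le> i" "i < L"
    "(a', b', c', d', S', T', L') \<in> set (families_2 m)" "0 \<le> j" "j < L'"
    "\<bar>S + 2 * i\<bar> = \<bar>S' + 2 * j\<bar>"
  shows "a + i = a' + j \<and> b + i = b' + j \<and> c + i = c' + j \<and> d - 3 * i = d' - 3 * j"
  using assms unfolding families_2_def list.set abs_eq_iff
  by - (elim insertE emptyE Pair_inject disjE; hypsubst_thin; (intro conjI)?; (linarith | (drule arg_cong[where f = "even :: int \<Rightarrow> bool"], simp; fail) | presburger))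

lemma diagonal_2_2:
  assumes "m \<ge> 0" "(a, b, c, d, S, T, L) \<in> set (families_2 m)" "0 \<le> i" "i < L"
    "(a', b', c', d', S', T', L') \<in> set (families_2 m)" "0 \<le> j" "j < L'"
    "\<bar>T + 2 * i\<bar> = \<bar>T' + 2 * j\<bar>"
  shows "a + i = a' + j \<and> b + i = b' + j \<and> c + i = c' + j \<and> d - 3 * i = d' - 3 * j"
  using assms unfolding families_2_def list.set abs_eq_iff
  by - (elim insertE emptyE Pair_inject disjE; hypsubst_thin; (intro conjI)?; (linarith | (drule arg_cong[where f = "even :: int \<Rightarrow> bool"], simp; fail) | presburger))

lemma diagonal_12_2:
  assumes "m \<ge> 0" "(a, b, c, d, S, T, L) \<in> set (families_2 m)" "0 \<le> i" "i < L"
    "(a', b', c', d', S', T', L') \<in> set (families_2 m)" "0 \<le> j" "j < L'"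
    "\<bar>S + 2 * i\<bar> = \<bar>T' + 2 * j\<bar>"
  shows False
  using assms unfolding families_2_def list.set abs_eq_iff
  by - (elim insertE emptyE Pair_inject disjE; hypsubst_thin; (intro conjI)?; (linarith | (drule arg_cong[where f = "even :: int \<Rightarrow> bool"], simp; fail) | presburger))

lemma base_families_2:
  fixes m :: nat
  assumes "m \<ge> 0"
  shows "base_families (3 * m + 2) (families_2 (int m))"
proof
  have m: "int m \<ge> 0" using assms by simp
  have N: "4 * int (3 * m + 2) = 12 * int m + 8" by simp
  show "(\<Sum>f\<leftarrow>families_2 (int m). nat (family_size f)) \<le> 3 * m + 2"
    by (simp add: families_2_def nat_add_distrib)
  show "\<exists>f\<in>set (families_2 (int m)). \<exists>i. covers f i z" if "1 \<le> z" "z \<le> 4 * int (3 * m + 2)" for z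
    using covered_2[OF m that(1)] that(2) unfolding N by blast
  fix a b c d S T L assume 1: "(a, b, c, d, S, T, L) \<in> set (families_2 (int m))"
  show "a + b + c + d = 0"
    using 1 by (auto simp: families_2_def)
  show "S - (a + b) \<in> {0, 8 * int (3 * m + 2) + 1, - (8 * int (3 * m + 2) + 1)} \<and>
    T - (b + c) \<in> {0, 8 * int (3 * m + 2) + 1, - (8 * int (3 * m + 2) + 1)}"
    using 1 by (auto simp: families_2_def)
  fix i :: int assume i: "0 \<le> i" "i < L"
  show "w \<noteq> 0 \<and> \<bar>w\<bar> \<le> 4 * int (3 * m + 2)"
    if "w \<in> {a + i, b + i, c + i, d - 3 * i, S + 2 * i, T + 2 * i}" for w
    unfolding N using range_2[OF m 1 i that] by blast
  fix a' b' c' d' S' T' L' j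
  assume 2: "(a', b', c', d', S', T', L') \<in> set (families_2 (int m))" and j: "0 \<le> j" "j < L'"
  show "a + i = a' + j \<and> b + i = b' + j \<and> c + i = c' + j \<and> d - 3 * i = d' - 3 * j"
    if "\<bar>S + 2 * i\<bar> = \<bar>S' + 2 * j\<bar>"
    using diagonal_1_2[OF m 1 i 2 j that] .
  show "a + i = a' + j \<and> b + i = b' + j \<and> c + i = c' + j \<and> d - 3 * i = d' - 3 * j"
    if "\<bar>T + 2 * i\<bar> = \<bar>T' + 2 * j\<bar>"
    using diagonal_2_2[OF m 1 i 2 j that] .
  show "\<bar>S + 2 * i\<bar> \<noteq> \<bar>T' + 2 * j\<bar>"
    using diagonal_12_2[OF m 1 i 2 j] by blast
qed

section \<open>Differences, diagonals and periodic orbits for \<open>n = 3 * m + 3\<close>\<close>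

lemma triangle_3:
  assumes "m \<ge> 0" "arcs (families_3 m) 0 k t u" "arcs (families_3 m) 0 l u w" "arcs (families_3 m) 0 p w t"
  shows "(k, l, p) \<in> set
    [(0, 5, 20), (3, 6, 17), (3, 19, 17), (5, 20, 0), (6, 17, 3), (17, 3, 6), (17, 3, 19), (19, 17,
     3), (20, 0, 5)]"
proof -
  have "(k, l, p) \<in> set triangles_3"
    using closed_inD[OF closed_in_3] successor_3[OF assms(1-3)] successor_3[OF assms(1,3,4)]
      successor_3[OF assms(1,4,2)] by blast
  then show ?thesis
    using assms(1) assms(2-4)[THEN arcs_families_3D] unfolding triangles_3_def list.set
    by - (elim insertE emptyE Pair_inject; hypsubst_thin; simp (no_asm_use); elim conjE; linarith)
qed

lemma no_two_triangles_3:
  assumes "m \<ge> 0" "arcs (families_3 m) 0 k t u" "arcs (families_3 m) 0 l u w" "arcs (families_3 m) 0 p w t"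
    "arcs (families_3 m) 0 k' (- t) u'" "arcs (families_3 m) 0 l' u' w'" "arcs (families_3 m) 0 p' w' (- t)"
  shows False
  using triangle_3[OF assms(1-4)] triangle_3[OF assms(1,5-7)] assms(1) assms(2-7)[THEN arcs_families_3D]
  unfolding list.set
  by - (elim insertE emptyE Pair_inject; hypsubst_thin; simp (no_asm_use); elim conjE; linarith)

lemma covered_3:
  assumes "m \<ge> 0" "1 \<le> z" "z \<le> 12 * m + 12"
  shows "\<exists>f\<in>set (families_3 m). \<exists>i. covers f i z"
proof -
  have abs: "\<bar>z\<bar> = z" using assms(2) by simp
  have start: "\<not> z \<le> 0" using assms(2) by simp
  have 0: ?thesis if "\<not> z \<le> 0" "z \<le> m + 1"
    by (rule coversI[of 1 _ "z - (1)"]) (use that abs assms(1) in \<open>simp_all add: families_3_def\<close>)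
  have 1: ?thesis if "\<not> z \<le> m + 1" "z \<le> m + 2"
    by (rule coversI[of 3 _ "0"]) (use that abs assms(1) in \<open>simp_all add: families_3_def\<close>)
  have 2: ?thesis if "\<not> z \<le> m + 2" "z \<le> 2 * m + 2"
    by (rule coversI[of 2 _ "z - (m + 3)"]) (use that abs assms(1) in \<open>simp_all add: families_3_def\<close>)
  have 3: ?thesis if "\<not> z \<le> 2 * m + 2" "z \<le> 2 * m + 3"
    by (rule coversI[of 3 _ "- z - (- 2 * m - 3)"]) (use that abs assms(1) in \<open>simp_all add: families_3_def\<close>)
  \<comment> \<open>The first two families are longer by one, which gives an interval of length 3m +
    2.\<close>
  have 4: ?thesis if that: "\<not> z \<le> 2 * m + 3" "z \<le> 5 * m + 5"
  proof -
    have "\<exists>i. z = 2 * m + 4 + 3 * i \<or> z = 2 * m + 5 + 3 * i \<or> z = 2 * m + 6 + 3 * i" by presburger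
    then obtain i where "z = 2 * m + 4 + 3 * i \<or> z = 2 * m + 5 + 3 * i \<or> z = 2 * m + 6 + 3 * i" ..
    then show ?thesis
      by (elim disjE) ((rule coversI[of 0 _ i], simp add: families_3_def, use that assms(1) in \<open>simp add: families_3_def abs_if\<close>), (rule coversI[of 1 _ i], simp add: families_3_def, use that assms(1) in \<open>simp add: families_3_def abs_if\<close>), (rule coversI[of 2 _ i], simp add: families_3_def, use that assms(1) in \<open>simp add: families_3_def abs_if\<close>))
  qed
  have 5: ?thesis if "\<not> z \<le> 5 * m + 5" "z \<le> 6 * m + 6"
    by (rule coversI[of 0 _ "z - (5 * m + 6)"]) (use that abs assms(1) in \<open>simp_all add: families_3_def\<close>)
  have 6: ?thesis if "\<not> z \<le> 6 * m + 6" "z \<le> 7 * m + 6"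
    by (rule coversI[of 2 _ "- z - (- 7 * m - 6)"]) (use that abs assms(1) in \<open>simp_all add: families_3_def\<close>)
  have 7: ?thesis if "\<not> z \<le> 7 * m + 6" "z \<le> 8 * m + 7"
    by (rule coversI[of 1 _ "- z - (- 8 * m - 7)"]) (use that abs assms(1) in \<open>simp_all add: families_3_def\<close>)
  have 8: ?thesis if "\<not> z \<le> 8 * m + 7" "z \<le> 8 * m + 8"
    by (rule coversI[of 3 _ "- z - (- 8 * m - 8)"]) (use that abs assms(1) in \<open>simp_all add: families_3_def\<close>)
  have 9: ?thesis if "\<not> z \<le> 8 * m + 8" "z \<le> 9 * m + 8"
    by (rule coversI[of 2 _ "z - (8 * m + 9)"]) (use that abs assms(1) in \<open>simp_all add: families_3_def\<close>)
  have 10: ?thesis if "\<not> z \<le> 9 * m + 8" "z \<le> 9 * m + 9"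
    by (rule coversI[of 3 _ "z - (9 * m + 9)"]) (use that abs assms(1) in \<open>simp_all add: families_3_def\<close>)
  have 11: ?thesis if "\<not> z \<le> 9 * m + 9" "z \<le> 10 * m + 10"
    by (rule coversI[of 0 _ "z - (9 * m + 10)"]) (use that abs assms(1) in \<open>simp_all add: families_3_def\<close>)
  have 12: ?thesis if "\<not> z \<le> 10 * m + 10" "z \<le> 11 * m + 11"
    by (rule coversI[of 1 _ "z - (10 * m + 11)"]) (use that abs assms(1) in \<open>simp_all add: families_3_def\<close>)
  have 13: ?thesis if "\<not> z \<le> 11 * m + 11" "z \<le> 12 * m + 12"
    by (rule coversI[of 0 _ "- z - (- 12 * m - 12)"]) (use that abs assms(1) in \<open>simp_all add: families_3_def\<close>)
  show ?thesis
    using start assms(3) 0 1 2 3 4 5 6 7 8 9 10 11 12 13 by satx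
qed

lemma range_3:
  assumes "m \<ge> 0" "(a, b, c, d, S, T, L) \<in> set (families_3 m)" "0 \<le> i" "i < L"
    "w \<in> {a + i, b + i, c + i, d - 3 * i, S + 2 * i, T + 2 * i}"
  shows "w \<noteq> 0 \<and> \<bar>w\<bar> \<le> 12 * m + 12"
  using assms unfolding families_3_def list.set abs_le_iff
  by - (elim insertE emptyE Pair_inject; hypsubst_thin; intro conjI notI; linarith)

text \<open>Here the ranges are disjoint: in absolute value they are 8m + 9 to 10m + 9, 6m + 6 to 8m
  + 6, 4m + 5 to 6m + 3, and the single value m + 1.\<close>

lemma diagonal_1_3:
  assumes "m \<ge> 0" "(a, b, c, d, S, T, L) \<in> set (families_3 m)" "0 \<le> i" "i < L"
    "(a', b', c', d', S', T', L') \<in> set (families_3 m)" "0 \<le> j" "j < L'"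
    "\<bar>S + 2 * i\<bar> = \<bar>S' + 2 * j\<bar>"
  shows "a + i = a' + j \<and> b + i = b' + j \<and> c + i = c' + j \<and> d - 3 * i = d' - 3 * j"
  using assms unfolding families_3_def list.set abs_eq_iff
  by - (elim insertE emptyE Pair_inject disjE; hypsubst_thin; (intro conjI)?; (linarith | (drule arg_cong[where f = "even :: int \<Rightarrow> bool"], simp; fail) | presburger))

text \<open>Only m + 2 to 3m + 2 and m + 3 to 3m + 1 overlap, again with opposite parities.\<close>

lemma diagonal_2_3:
  assumes "m \<ge> 0" "(a, b, c, d, S, T, L) \<in> set (families_3 m)" "0 \<le> i" "i < L"
    "(a', b', c', d', S', T', L') \<in> set (families_3 m)" "0 \<le> j" "j < L'"
    "\<bar>T + 2 * i\<bar> = \<bar>T' + 2 * j\<bar>"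
  shows "a + i = a' + j \<and> b + i = b' + j \<and> c + i = c' + j \<and> d - 3 * i = d' - 3 * j"
  using assms unfolding families_3_def list.set abs_eq_iff
  by - (elim insertE emptyE Pair_inject disjE; hypsubst_thin; (intro conjI)?; (linarith | (drule arg_cong[where f = "even :: int \<Rightarrow> bool"], simp; fail) | presburger))

lemma diagonal_12_3:
  assumes "m \<ge> 0" "(a, b, c, d, S, T, L) \<in> set (families_3 m)" "0 \<le> i" "i < L"
    "(a', b', c', d', S', T', L') \<in> set (families_3 m)" "0 \<le> j" "j < L'"
    "\<bar>S + 2 * i\<bar> = \<bar>T' + 2 * j\<bar>"
  shows False
  using assms unfolding families_3_def list.set abs_eq_iff
  by - (elim insertE emptyE Pair_inject disjE; hypsubst_thin; (intro conjI)?; (linarith | (drule arg_cong[where f = "even :: int \<Rightarrow> bool"], simp; fail) | presburger))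

lemma base_families_3:
  fixes m :: nat
  assumes "m \<ge> 0"
  shows "base_families (3 * m + 3) (families_3 (int m))"
proof
  have m: "int m \<ge> 0" using assms by simp
  have N: "4 * int (3 * m + 3) = 12 * int m + 12" by simp
  show "(\<Sum>f\<leftarrow>families_3 (int m). nat (family_size f)) \<le> 3 * m + 3"
    by (simp add: families_3_def nat_add_distrib)
  show "\<exists>f\<in>set (families_3 (int m)). \<exists>i. covers f i z" if "1 \<le> z" "z \<le> 4 * int (3 * m + 3)" for z
    using covered_3[OF m that(1)] that(2) unfolding N by blast
  fix a b c d S T L assume 1: "(a, b, c, d, S, T, L) \<in> set (families_3 (int m))"
  show "a + b + c + d = 0"
    using 1 by (auto simp: families_3_def)
  show "S - (a + b) \<in> {0, 8 * int (3 * m + 3) + 1, - (8 * int (3 * m + 3) + 1)} \<and>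
    T - (b + c) \<in> {0, 8 * int (3 * m + 3) + 1, - (8 * int (3 * m + 3) + 1)}"
    using 1 by (auto simp: families_3_def)
  fix i :: int assume i: "0 \<le> i" "i < L"
  show "w \<noteq> 0 \<and> \<bar>w\<bar> \<le> 4 * int (3 * m + 3)"
    if "w \<in> {a + i, b + i, c + i, d - 3 * i, S + 2 * i, T + 2 * i}" for w
    unfolding N using range_3[OF m 1 i that] by blast
  fix a' b' c' d' S' T' L' j
  assume 2: "(a', b', c', d', S', T', L') \<in> set (families_3 (int m))" and j: "0 \<le> j" "j < L'"
  show "a + i = a' + j \<and> b + i = b' + j \<and> c + i = c' + j \<and> d - 3 * i = d' - 3 * j"
    if "\<bar>S + 2 * i\<bar> = \<bar>S' + 2 * j\<bar>"
    using diagonal_1_3[OF m 1 i 2 j that] .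
  show "a + i = a' + j \<and> b + i = b' + j \<and> c + i = c' + j \<and> d - 3 * i = d' - 3 * j"
    if "\<bar>T + 2 * i\<bar> = \<bar>T' + 2 * j\<bar>"
    using diagonal_2_3[OF m 1 i 2 j that] .
  show "\<bar>S + 2 * i\<bar> \<noteq> \<bar>T' + 2 * j\<bar>"
    using diagonal_12_3[OF m 1 i 2 j] by blast
qed

section \<open>Existence\<close>

lemma base_families_9: "base_families 1 [(1, -2, 4, -3, -1, 2, 1)]"
proof
  fix z :: int assume "1 \<le> z" "z \<le> 4 * int 1"
  then have "z = 1 \<or> z = 2 \<or> z = 3 \<or> z = 4" by auto
  then show "\<exists>f\<in>set [(1, -2, 4, -3, -1, 2, 1)]. \<exists>i. covers f i z"
    by (intro coversI[of 0 _ 0]) auto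
qed (auto, presburger)

text \<open>
  On nine points, the four cycles of a forbidden configuration would avoid two points, but at most
  three cycles of the system do.
\<close>

lemma exists_9: "\<exists>\<C> :: nat set set set. four_cycle_system 9 {..<9} \<C> \<and> strictly_sparse 4 \<C>"
proof -
  interpret base_families 1 "[(1, -2, 4, -3, -1, 2, 1)]"
    by (rule base_families_9)
  interpret cyclic_base 1 Q .
  \<comment> \<open>The orbit criterion fails for this base cycle: 1 -> -1 -> 2 -> 1 makes both 1
    and -1 periodic. The offsets 0, 1, -1, 3 are the partial sums of the differences.\<close>
  have few: "\<forall>x\<in>set [0..<9]. \<forall>y\<in>set [0..<9]. x \<noteq> y \<longrightarrow> length (filter (\<lambda>k.
      x \<notin> set (map (\<lambda>s. nat ((k + s) mod 9)) [0, 1, -1, 3]) \<and> y \<notin> set (map (\<lambda>s. nat ((k + s) mod 9)) [0, 1, -1, 3]))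
      [0..8 :: int]) \<le> 3"
    by code_simp
  have Q: "Q = {(1, -2, 4, -3)}" by auto
  define f where "f k = translate (1, -2, 4, -3) k" for k
  have f: "\<Union>(f k) = set (map (\<lambda>s. nat ((k + s) mod 9)) [0, 1, -1, 3])" for k
    unfolding f_def translate.simps Union_cycle4 vertex_def by (simp add: algebra_simps)
  have img: "(\<lambda>(q, k). g q k) ` ({c} \<times> A) = g c ` A" for g :: "'b \<Rightarrow> 'c \<Rightarrow> 'd" and c A
    by force
  have "system = (\<lambda>(q, k). translate q k) ` (Q \<times> {0..<v})"
    by (rule system_eq)
  also have "\<dots> = translate (1, -2, 4, -3) ` {0..<v}"
    unfolding Q by (rule img)
  also have "{0..<v} = set [0..8]"
    by auto
  finally have system: "system = f ` set [0..8]"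
    unfolding f_def .
  have "\<not> configuration system 7 4 S" for S
  proof
    assume "configuration system 7 4 S"
    then have S: "S \<subseteq> system" "card S = 4" "card (\<Union>(\<Union>S)) = 7"
      unfolding configuration_def by auto
    have sub: "\<Union>(\<Union>S) \<subseteq> {..<9}"
      using S(1) Union_translate by fastforce
    have "card ({..<9} - \<Union>(\<Union>S)) = 2"
      using S(3) sub by (subst card_Diff_subset) (auto intro: finite_subset)
    then obtain x y where xy: "x \<noteq> y" "{..<9} - \<Union>(\<Union>S) = {x, y}"
      unfolding card_2_iff by blast
    have mem: "x \<in> set [0..<9]" "y \<in> set [0..<9]" using xy(2) by auto
    let ?K = "filter (\<lambda>k. x \<notin> set (map (\<lambda>s. nat ((k + s) mod 9)) [0, 1, -1, 3]) \<and>
      y \<notin> set (map (\<lambda>s. nat ((k + s) mod 9)) [0, 1, -1, 3])) [0..8]"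
    have "S \<subseteq> f ` set ?K"
    proof
      fix X assume X: "X \<in> S"
      then obtain k where k: "X = f k" "k \<in> set [0..8]"
        using S(1) unfolding system by blast
      have "x \<notin> \<Union>X" "y \<notin> \<Union>X" using X xy(2) by blast+
      then have "k \<in> set ?K"
        using k(2) unfolding k(1) f by simp
      then show "X \<in> f ` set ?K" using k(1) by blast
    qed
    then have "card S \<le> card (set ?K)"
      using surj_card_le by blast
    also have "\<dots> \<le> length ?K" by (rule card_length)
    also have "\<dots> \<le> 3" using few mem xy(1) by blast
    finally show False using S(2) by simp
  qed
  then have "strictly_sparse 4 system"
    unfolding strictly_sparse_def using sparse_4_if_no_7_4 D_avoiding by blast
  then show ?thesis
    using four_cycle_system by auto
qed

lemma exists_1: "\<exists>\<C> :: nat set set set. four_cycle_system 1 {..<1} \<C> \<and> strictly_sparse 4 \<C>"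
proof (intro exI conjI)
  have "complete_edges {..<1 :: nat} = {}"
    unfolding complete_edges_def by (auto dest: card_mono[rotated])
  then show "four_cycle_system 1 {..<1 :: nat} {}"
    unfolding four_cycle_system_def by (simp add: partition_on_empty)
  show "strictly_sparse 4 ({} :: nat set set set)"
    unfolding strictly_sparse_def sparse_def D_avoiding_def configuration_def by auto
qed

lemma (in base_families) exists_system:
  assumes "\<And>t u w u' w' k l p k' l' p'. arcs fs 0 k t u \<Longrightarrow> arcs fs 0 l u w \<Longrightarrow> arcs fs 0 p w t \<Longrightarrow>
    arcs fs 0 k' (- t) u' \<Longrightarrow> arcs fs 0 l' u' w' \<Longrightarrow> arcs fs 0 p' w' (- t) \<Longrightarrow> False"
  shows "\<exists>\<C>. four_cycle_system (8 * n + 1) {..<8 * n + 1} \<C> \<and> strictly_sparse 4 \<C>"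
proof (intro exI conjI)
  show "four_cycle_system (8 * n + 1) {..<8 * n + 1} system"
    by (rule four_cycle_system)
  show "strictly_sparse 4 system"
    using assms by (rule strictly_sparse_system_if)
qed

lemma exists_system:
  "\<exists>\<C> :: nat set set set. four_cycle_system (8 * n + 1) {..<8 * n + 1} \<C> \<and> strictly_sparse 4 \<C>"
proof -
  \<comment> \<open>The shift by one makes the remainders 1, 2, 3, so that \<open>n = 3\<close> is
    the case \<open>m = 0\<close> of the third list.\<close>
  define m where "m = (n - 1) div 3"
  consider "n = 0" | "n = 1" | "n = 3 * m + 1" "m \<ge> 1" | "n = 3 * m + 2" | "n = 3 * m + 3"
    unfolding m_def by linarith
  then show ?thesis
  proof cases
    case 1
    then show ?thesis using exists_1 by simp
  next
    case 2
    then show ?thesis using exists_9 by simp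
  next
    case 3
    show ?thesis
      unfolding 3(1) using base_families.exists_system[OF base_families_1] no_two_triangles_1[of "int m"] 3(2)
      by (metis of_nat_1 of_nat_mono)
  next
    case 4
    show ?thesis
      unfolding 4 using base_families.exists_system[OF base_families_2] no_two_triangles_2[of "int m"]
      by (metis of_nat_0_le_iff zero_le)
  next
    case 5
    show ?thesis
      unfolding 5 using base_families.exists_system[OF base_families_3] no_two_triangles_3[of "int m"]
      by (metis of_nat_0_le_iff zero_le)
  qed
qed

theorem theorem6:
  fixes v :: nat
  assumes "v \<ge> 1"
  shows "(\<exists>(V :: nat set) \<C>. four_cycle_system v V \<C> \<and> strictly_sparse 4 \<C>) \<longleftrightarrow> v mod 8 = 1"
proof
  assume "\<exists>(V :: nat set) \<C>. four_cycle_system v V \<C> \<and> strictly_sparse 4 \<C>"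
  then show "v mod 8 = 1"
    using four_cycle_system_mod_8 assms by blast
next
  assume "v mod 8 = 1"
  then have "v = 8 * (v div 8) + 1"
    using div_mult_mod_eq[of v 8] by simp
  then show "\<exists>(V :: nat set) \<C>. four_cycle_system v V \<C> \<and> strictly_sparse 4 \<C>"
    using exists_system[of "v div 8"] by metis
qed

end
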